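(* There is an $O(N\,\mathrm{poly}(D))$-time reduction from a Restricted OAPT instance with two sets $A,B$ of $N$ tensors of size $D$ to an instance of Regular Expression Membership Testing with a regular expression $R$ of length $O(N\,\mathrm{poly}(D))$ and a string $S$ of length $O(N\,\mathrm{poly}(D))$ (the answer is preserved).
   Context: For even $t$, tensors $u,v\in\{0,1\}^{2\times\cdots\times2}$ ($t$ factors, size $D=2^t$) indexed by $i\in\{0,1\}^t$ have alternating product $p_{\mathrm{alt}}(u,v)=\bigwedge_{i_1}\bigvee_{i_2}\bigwedge_{i_3}\cdots\bigvee_{i_t}(u_i\wedge v_i)$. A tensor $x$ is $\wedge$-invariant if $x_i$ does not depend on $i_1,i_3,\dots,i_{t-1}$. Restricted OAPT: given two sets $A,B$ of $N$ such tensors, where one of the two sets contains only $\wedge$-invariant tensors, decide whether some $(a,b)\in A\times B$ has $p_{\mathrm{alt}}(a,b)=0$. Regular expressions are built from symbols by concatenation, alternation $[R\mid S]$, $[R]^+$, $[R]^*$, with language $L(\cdot)$. Regular Expression Membership Testing: given a regular expression $p$ and a string $s$, decide whether $s\in L(p)$. *)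

theory Defs
  imports Main "HOL-Library.FuncSet"
begin

section \<open>Tensors and Restricted OAPT\<close>

text \<open>
  An index \<open>(i\<^sub>1, \<dots>, i\<^sub>t)\<close> is a list of length \<open>t\<close>, with \<open>i\<^sub>k\<close> at list position \<open>k - 1\<close>.
  Tensors are extensional functions, so that sets of tensors have the right cardinality.
\<close>

definition idx :: "nat \<Rightarrow> bool list set" where
  "idx t = {i. length i = t}"

definition tensors :: "nat \<Rightarrow> (bool list \<Rightarrow> bool) set" where
  "tensors t = idx t \<rightarrow>\<^sub>E UNIV"

fun alt_and :: "nat \<Rightarrow> (bool list \<Rightarrow> bool) \<Rightarrow> bool"
  and alt_or :: "nat \<Rightarrow> (bool list \<Rightarrow> bool) \<Rightarrow> bool" where
  "alt_and 0 f = f []"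
| "alt_and (Suc t) f = (\<forall>b. alt_or t (\<lambda>i. f (b # i)))"
| "alt_or 0 f = f []"
| "alt_or (Suc t) f = (\<exists>b. alt_and t (\<lambda>i. f (b # i)))"

definition p_alt :: "nat \<Rightarrow> (bool list \<Rightarrow> bool) \<Rightarrow> (bool list \<Rightarrow> bool) \<Rightarrow> bool" where
  "p_alt t u v = alt_and t (\<lambda>i. u i \<and> v i)"

text \<open>The list positions of \<open>i\<^sub>2, i\<^sub>4, \<dots>, i\<^sub>t\<close> are the odd ones.\<close>

definition and_invariant :: "nat \<Rightarrow> (bool list \<Rightarrow> bool) \<Rightarrow> bool" where
  "and_invariant t x \<longleftrightarrow>
     (\<forall>i\<in>idx t. \<forall>j\<in>idx t. (\<forall>k<t. odd k \<longrightarrow> i ! k = j ! k) \<longrightarrow> x i = x j)"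

definition restricted_OAPT_instance ::
  "nat \<Rightarrow> nat \<Rightarrow> (bool list \<Rightarrow> bool) set \<Rightarrow> (bool list \<Rightarrow> bool) set \<Rightarrow> bool" where
  "restricted_OAPT_instance t N A B \<longleftrightarrow>
     even t \<and> 1 \<le> N \<and> A \<subseteq> tensors t \<and> B \<subseteq> tensors t \<and> card A = N \<and> card B = N \<and>
     ((\<forall>x\<in>A. and_invariant t x) \<or> (\<forall>x\<in>B. and_invariant t x))"

definition OAPT :: "nat \<Rightarrow> (bool list \<Rightarrow> bool) set \<Rightarrow> (bool list \<Rightarrow> bool) set \<Rightarrow> bool" where
  "OAPT t A B \<longleftrightarrow> (\<exists>a\<in>A. \<exists>b\<in>B. \<not> p_alt t a b)"

section \<open>Regular expressions\<close>

datatype 'a regex =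
    RSym 'a
  | RCat "'a regex" "'a regex"
  | RAlt "'a regex" "'a regex"
  | RPlus "'a regex"
  | RStar "'a regex"

definition conc :: "'a list set \<Rightarrow> 'a list set \<Rightarrow> 'a list set" where
  "conc X Y = {x @ y | x y. x \<in> X \<and> y \<in> Y}"

inductive_set star :: "'a list set \<Rightarrow> 'a list set" for X where
  star_Nil: "[] \<in> star X"
| star_append: "x \<in> X \<Longrightarrow> y \<in> star X \<Longrightarrow> x @ y \<in> star X"

primrec lang :: "'a regex \<Rightarrow> 'a list set" where
  "lang (RSym a) = {[a]}"
| "lang (RCat r s) = conc (lang r) (lang s)"
| "lang (RAlt r s) = lang r \<union> lang s"
| "lang (RPlus r) = conc (lang r) (star (lang r))"
| "lang (RStar r) = star (lang r)"

text \<open>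
  The written form of a regular expression: concatenation is juxtaposition, the other
  operators are \<open>[R|S]\<close>, \<open>[R]+\<close>, \<open>[R]*\<close>.  It determines the expression up to associativity
  of concatenation, hence it determines the language.  Its length is the length of the
  expression.
\<close>

datatype 'a token = TSym 'a | TOpen | TBar | TClose | TPlus | TStar

primrec written :: "'a regex \<Rightarrow> 'a token list" where
  "written (RSym a) = [TSym a]"
| "written (RCat r s) = written r @ written s"
| "written (RAlt r s) = TOpen # written r @ TBar # written s @ [TClose]"
| "written (RPlus r) = TOpen # written r @ [TClose, TPlus]"
| "written (RStar r) = TOpen # written r @ [TClose, TStar]"

definition regex_length :: "'a regex \<Rightarrow> nat" where
  "regex_length r = length (written r)"

section \<open>Word RAM\<close>

text \<open>
  Structured programs of a word RAM with \<open>w\<close>-bit words.  A configuration consists of the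
  registers, of which a program can mention only finitely many, and a random access memory;
  both hold words.  Every instruction and every test takes one time unit.  Subtraction is
  truncated at 0.
\<close>

datatype prog =
    Const nat nat
  | Add nat nat nat
  | Sub nat nat nat
  | Load nat nat
  | Store nat nat
  | Seq prog prog
  | IfLess nat nat prog prog
  | WhileLess nat nat prog

type_synonym config = "(nat \<Rightarrow> nat) \<times> (nat \<Rightarrow> nat)"

inductive exec :: "nat \<Rightarrow> prog \<Rightarrow> config \<Rightarrow> nat \<Rightarrow> config \<Rightarrow> bool" for w where
  Const: "exec w (Const x k) (r, m) 1 (r(x := k mod 2 ^ w), m)"
| Add: "exec w (Add x y z) (r, m) 1 (r(x := (r y + r z) mod 2 ^ w), m)"
| Sub: "exec w (Sub x y z) (r, m) 1 (r(x := r y - r z), m)"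
| Load: "exec w (Load x y) (r, m) 1 (r(x := m (r y)), m)"
| Store: "exec w (Store x y) (r, m) 1 (r, m(r x := r y))"
| Seq: "exec w p s n s' \<Longrightarrow> exec w q s' n' s'' \<Longrightarrow> exec w (Seq p q) s (n + n') s''"
| IfTrue: "r x < r y \<Longrightarrow> exec w p (r, m) n s' \<Longrightarrow> exec w (IfLess x y p q) (r, m) (1 + n) s'"
| IfFalse: "\<not> r x < r y \<Longrightarrow> exec w q (r, m) n s' \<Longrightarrow> exec w (IfLess x y p q) (r, m) (1 + n) s'"
| WhileFalse: "\<not> r x < r y \<Longrightarrow> exec w (WhileLess x y p) (r, m) 1 (r, m)"
| WhileTrue: "r x < r y \<Longrightarrow> exec w p (r, m) n s' \<Longrightarrow> exec w (WhileLess x y p) s' n' s'' \<Longrightarrow>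
    exec w (WhileLess x y p) (r, m) (1 + n + n') s''"

lemma exec_deterministic:
  "exec w p s n s' \<Longrightarrow> exec w p s k s'' \<Longrightarrow> k = n \<and> s'' = s'"
proof (induction arbitrary: k s'' rule: exec.induct)
  case (Seq p s n s' q n' s1)
  from Seq.prems show ?case by cases (use Seq.IH in blast)
next
  case (WhileTrue r x y p m n s' n' s1)
  from WhileTrue.prems show ?case
    by cases (use WhileTrue.hyps WhileTrue.IH in blast)+
next
  case (IfTrue r x y p m n s' q)
  from IfTrue.prems show ?case by cases (use IfTrue.hyps IfTrue.IH in blast)+
next
  case (IfFalse r x y q m n s' p)
  from IfFalse.prems show ?case by cases (use IfFalse.hyps IfFalse.IH in blast)+
qed (erule exec.cases; simp)+

section \<open>Encoding of instances\<close>

fun indices :: "nat \<Rightarrow> bool list list" where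
  "indices 0 = [[]]"
| "indices (Suc t) = map ((#) False) (indices t) @ map ((#) True) (indices t)"

text \<open>One bit per word, the entries of a tensor in lexicographic order of their indices.\<close>

definition tensor_words :: "nat \<Rightarrow> (bool list \<Rightarrow> bool) \<Rightarrow> nat list" where
  "tensor_words t x = map (\<lambda>i. of_bool (x i)) (indices t)"

definition enumerates :: "'a list \<Rightarrow> 'a set \<Rightarrow> bool" where
  "enumerates xs X \<longleftrightarrow> distinct xs \<and> set xs = X"

text \<open>
  Registers 0 and 1 hold \<open>N\<close> and \<open>t\<close>; the tensors of the first set, followed by those of the
  second one, are stored from memory address 0 on.
\<close>

definition OAPT_input ::
  "nat \<Rightarrow> nat \<Rightarrow> (bool list \<Rightarrow> bool) list \<Rightarrow> (bool list \<Rightarrow> bool) list \<Rightarrow> config" where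
  "OAPT_input t N as bs =
     (let ws = concat (map (tensor_words t) (as @ bs))
      in ((\<lambda>_. 0)(0 := N, 1 := t), \<lambda>k. if k < length ws then ws ! k else 0))"

primrec token_word :: "nat token \<Rightarrow> nat" where
  "token_word TOpen = 0"
| "token_word TBar = 1"
| "token_word TClose = 2"
| "token_word TPlus = 3"
| "token_word TStar = 4"
| "token_word (TSym a) = a + 5"

definition stored_at :: "nat \<Rightarrow> (nat \<Rightarrow> nat) \<Rightarrow> nat \<Rightarrow> nat list \<Rightarrow> bool" where
  "stored_at w m p ws \<longleftrightarrow> p + length ws \<le> 2 ^ w \<and> (\<forall>k<length ws. m (p + k) = ws ! k)"

text \<open>
  Registers 0 and 1 hold the start address and the length of the written form of the
  expression, registers 2 and 3 those of the string.
\<close>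

definition membership_output :: "nat \<Rightarrow> config \<Rightarrow> nat regex \<Rightarrow> nat list \<Rightarrow> bool" where
  "membership_output w s R S \<longleftrightarrow>
     (case s of (r, m) \<Rightarrow>
        r 1 = regex_length R \<and> stored_at w m (r 0) (map token_word (written R)) \<and>
        r 3 = length S \<and> stored_at w m (r 2) S)"

end

theory Submission
  imports Defs
begin

text \<open>
  A tensor \<open>v\<close> is written as the word of its \<open>D\<close> bits, and for a tensor \<open>u\<close> there is an expression
  matching exactly the words of those \<open>v\<close> with \<open>p_alt(u, v) = 0\<close>.  Negating the alternating product
  turns each disjunction into a concatenation of the expressions for the two halves of the word,
  and each conjunction into an alternation: one half has to match while the other half, of known
  length, is skipped by a padding \<open>[0|1]\<dots>[0|1]\<close>.  At a leaf, \<open>[0|1]\<close> or \<open>[0|0]\<close> tests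
  \<open>\<not> (u\<^sub>i \<and> v\<^sub>i)\<close>.
  As all these words have length \<open>D\<close>, surrounding the alternation over \<open>A\<close> by starred paddings of
  length \<open>D\<close> makes it range over the tensors of \<open>B\<close> in their concatenation, which is already
  present in the input.

  The expressions for two further indices are made of the written forms of four expressions of
  one common length, so no recursion is needed to produce them: each level is an array of blocks
  obtained by combining four consecutive blocks of the previous level into one, and the program
  always reads the last level from left to right while appending the next one to the memory.
\<close>

section \<open>Languages of words of one length\<close>

lemma conc_append_iff:
  assumes "X \<subseteq> {x. length x = n}" and "length x = n"
  shows "x @ y \<in> conc X Y \<longleftrightarrow> x \<in> X \<and> y \<in> Y"
proof
  assume "x @ y \<in> conc X Y"
  then obtain x' y' where split: "x @ y = x' @ y'" and "x' \<in> X" "y' \<in> Y"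
    unfolding conc_def by blast
  moreover from assms \<open>x' \<in> X\<close> have "length x = length x'" by auto
  ultimately show "x \<in> X \<and> y \<in> Y" by simp
qed (auto simp: conc_def)

lemma conc_length_subset:
  assumes "X \<subseteq> {x. length x = n}" and "Y \<subseteq> {y. length y = k}"
  shows "conc X Y \<subseteq> {z. length z = n + k}"
  using assms unfolding conc_def by (auto simp: subset_iff)

lemma in_conc_insert_foreign_iff:
  assumes "c \<notin> set x"
  shows "x \<in> conc X (conc (insert [c] Y) Z) \<longleftrightarrow> x \<in> conc X (conc Y Z)"
proof
  assume "x \<in> conc X (conc (insert [c] Y) Z)"
  then obtain x1 y x2 where "x = x1 @ y @ x2" "x1 \<in> X" "y \<in> insert [c] Y" "x2 \<in> Z"
    unfolding conc_def by blast
  moreover from this assms have "y \<noteq> [c]" by auto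
  ultimately show "x \<in> conc X (conc Y Z)" unfolding conc_def by blast
qed (auto simp: conc_def)

lemma concat_in_star: "set xss \<subseteq> X \<Longrightarrow> concat xss \<in> star X"
  by (induction xss) (auto intro: star.intros)

lemma dvd_length_star:
  assumes "X \<subseteq> {x. length x = n}" and "x \<in> star X"
  shows "n dvd length x"
  using assms(2,1) by (induction rule: star.induct) auto

lemma drop_concat_uniform:
  "set xss \<subseteq> {x. length x = n} \<Longrightarrow> drop (n * i) (concat xss) = concat (drop i xss)"
proof (induction xss arbitrary: i)
  case (Cons x xss)
  then show ?case by (cases i) auto
qed simp

lemma in_star_conc_star_iff:
  assumes X: "X \<subseteq> {x. length x = n}" and Y: "Y \<subseteq> {x. length x = n}"
    and "0 < n" and xss: "set xss \<subseteq> X"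
  shows "concat xss \<in> conc (star X) (conc Y (star X)) \<longleftrightarrow> set xss \<inter> Y \<noteq> {}"
proof
  assume "set xss \<inter> Y \<noteq> {}"
  then obtain y yss zss where "y \<in> Y" and split: "xss = yss @ y # zss"
    by (meson disjoint_iff split_list)
  moreover have "concat yss \<in> star X" "concat zss \<in> star X"
    using xss split by (auto intro!: concat_in_star)
  ultimately show "concat xss \<in> conc (star X) (conc Y (star X))"
    unfolding conc_def by auto
next
  assume "concat xss \<in> conc (star X) (conc Y (star X))"
  then obtain x y z where split: "concat xss = x @ y @ z" and "x \<in> star X" and "y \<in> Y"
    unfolding conc_def by auto
  from X \<open>x \<in> star X\<close> obtain i where i: "length x = n * i"
    using dvd_length_star by blast
  have len: "set xss \<subseteq> {x. length x = n}" and "length y = n"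
    using X Y xss \<open>y \<in> Y\<close> by auto
  have rest: "concat (drop i xss) = y @ z"
    using drop_concat_uniform[OF len, of i] split i by simp
  with \<open>length y = n\<close> \<open>0 < n\<close> obtain x' zss where drop: "drop i xss = x' # zss"
    by (cases "drop i xss") auto
  then have "x' \<in> set xss" by (metis in_set_dropD list.set_intros(1))
  moreover have "x' = y"
    using rest drop len \<open>x' \<in> set xss\<close> \<open>length y = n\<close> by auto
  ultimately show "set xss \<inter> Y \<noteq> {}" using \<open>y \<in> Y\<close> by blast
qed

fun cat :: "'a regex list \<Rightarrow> 'a regex" where
  "cat [r] = r"
| "cat (r # s # rs) = RCat r (cat (s # rs))"

lemma lang_foldl_RAlt: "lang (foldl RAlt r rs) = lang r \<union> \<Union> (lang ` set rs)"
  by (induction rs arbitrary: r) auto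

section \<open>The expression of an instance\<close>

text \<open>
  The leaf for \<^const>\<open>True\<close> is \<open>[0|0]\<close> instead of \<open>0\<close> so that the written length of
  \<open>tensor_regex k u\<close> does not depend on \<open>u\<close>.
\<close>

definition leaf :: "bool \<Rightarrow> nat regex" where
  "leaf b = RAlt (RSym 0) (RSym (if b then 0 else 1))"

definition pad :: "nat \<Rightarrow> nat regex" where
  "pad n = cat (replicate n (leaf False))"

definition binary_words :: "nat \<Rightarrow> nat list set" where
  "binary_words n = {x. length x = n \<and> set x \<subseteq> {0, 1}}"

definition slice :: "(bool list \<Rightarrow> bool) \<Rightarrow> bool \<Rightarrow> bool \<Rightarrow> bool list \<Rightarrow> bool" where
  "slice u a b = (\<lambda>i. u (a # b # i))"

text \<open>
  The alternation guesses the value of the universal index for which the product fails and skips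
  the \<open>2 * 4 ^ k\<close> entries with the other value.
\<close>

fun tensor_regex :: "nat \<Rightarrow> (bool list \<Rightarrow> bool) \<Rightarrow> nat regex" where
  "tensor_regex 0 u = leaf (u [])"
| "tensor_regex (Suc k) u =
    RAlt
      (cat [tensor_regex k (slice u False False), tensor_regex k (slice u False True),
            pad (2 * 4 ^ k)])
      (cat [pad (2 * 4 ^ k),
            tensor_regex k (slice u True False), tensor_regex k (slice u True True)])"

text \<open>The symbol \<open>2\<close> occurs in no input word; it stands for the empty alternation.\<close>

definition OAPT_regex :: "nat \<Rightarrow> (bool list \<Rightarrow> bool) list \<Rightarrow> nat regex" where
  "OAPT_regex k us =
     cat [RStar (pad (4 ^ k)), foldl RAlt (RSym 2) (map (tensor_regex k) us), RStar (pad (4 ^ k))]"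

lemma lang_leaf: "lang (leaf b) = (if b then {[0]} else {[0], [1]})"
  by (auto simp: leaf_def)

lemma binary_words_length: "binary_words n \<subseteq> {x. length x = n}"
  by (auto simp: binary_words_def)

lemma binary_words_append:
  "x \<in> binary_words n \<Longrightarrow> y \<in> binary_words k \<Longrightarrow> x @ y \<in> binary_words (n + k)"
  by (auto simp: binary_words_def)

lemma conc_binary_words_Suc: "conc {[0], [1]} (binary_words n) = binary_words (Suc n)"
proof (rule set_eqI)
  fix x :: "nat list"
  have "x \<in> conc {[0], [1]} (binary_words n) \<longleftrightarrow>
      (\<exists>b y. x = [b] @ y \<and> b \<in> {0, 1} \<and> y \<in> binary_words n)"
    unfolding conc_def by blast
  also have "\<dots> \<longleftrightarrow> x \<in> binary_words (Suc n)"
    by (cases x) (auto simp: binary_words_def)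
  finally show "x \<in> conc {[0], [1]} (binary_words n) \<longleftrightarrow> x \<in> binary_words (Suc n)" .
qed

lemma lang_pad: "0 < n \<Longrightarrow> lang (pad n) = binary_words n"
proof (induction n rule: nat_induct_non_zero)
  case 1
  show ?case by (auto simp: pad_def lang_leaf binary_words_def length_Suc_conv)
next
  case (Suc n)
  have "pad (Suc n) = RCat (leaf False) (pad n)"
    using Suc.hyps by (cases n) (simp_all add: pad_def)
  then have "lang (pad (Suc n)) = conc {[0], [1]} (binary_words n)"
    by (simp add: Suc.IH lang_leaf)
  then show ?case by (simp only: conc_binary_words_Suc)
qed

lemma lang_tensor_regex_Suc:
  "lang (tensor_regex (Suc k) u) =
     conc (lang (tensor_regex k (slice u False False)))
       (conc (lang (tensor_regex k (slice u False True))) (binary_words (2 * 4 ^ k))) \<union>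
     conc (binary_words (2 * 4 ^ k))
       (conc (lang (tensor_regex k (slice u True False))) (lang (tensor_regex k (slice u True True))))"
  by (simp add: lang_pad)

lemma lang_tensor_regex_length: "lang (tensor_regex k u) \<subseteq> {x. length x = 4 ^ k}"
proof (induction k arbitrary: u)
  case 0
  show ?case by (auto simp: lang_leaf)
next
  case (Suc k)
  have "4 ^ k + (4 ^ k + 2 * 4 ^ k) = (4::nat) ^ Suc k"
    and "2 * 4 ^ k + (4 ^ k + 4 ^ k) = (4::nat) ^ Suc k"
    by simp_all
  then show ?case
    using conc_length_subset[OF Suc conc_length_subset[OF Suc binary_words_length]]
      conc_length_subset[OF binary_words_length conc_length_subset[OF Suc Suc]]
    unfolding lang_tensor_regex_Suc by (metis Un_least)
qed

lemma length_indices: "length (indices t) = 2 ^ t"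
  by (induction t) simp_all

lemma tensor_words_binary: "tensor_words t v \<in> binary_words (2 ^ t)"
  by (auto simp: tensor_words_def binary_words_def length_indices)

lemma length_tensor_words [simp]: "length (tensor_words t v) = 2 ^ t"
  using tensor_words_binary binary_words_length by blast

lemma length_concat_map_tensor_words [simp]:
  "length (concat (map (tensor_words t) vs)) = length vs * 2 ^ t"
  by (induction vs) simp_all

lemma tensor_words_slices:
  "tensor_words (2 * Suc k) v =
     tensor_words (2 * k) (slice v False False) @ tensor_words (2 * k) (slice v False True) @
     tensor_words (2 * k) (slice v True False) @ tensor_words (2 * k) (slice v True True)"
  by (simp add: tensor_words_def slice_def comp_def)

lemma p_alt_slices:
  "p_alt (2 * Suc k) u v \<longleftrightarrow> (\<forall>a. \<exists>b. p_alt (2 * k) (slice u a b) (slice v a b))"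
  by (simp add: p_alt_def slice_def)

lemma tensor_words_in_lang_iff:
  "tensor_words (2 * k) v \<in> lang (tensor_regex k u) \<longleftrightarrow> \<not> p_alt (2 * k) u v"
proof (induction k arbitrary: u v)
  case 0
  show ?case by (simp add: lang_leaf p_alt_def tensor_words_def)
next
  case (Suc k)
  let ?W = "\<lambda>a b. tensor_words (2 * k) (slice v a b)"
  let ?R = "\<lambda>a b. lang (tensor_regex k (slice u a b))"
  let ?P = "binary_words (2 * 4 ^ k)"
  have len: "length (?W a b) = 4 ^ k" for a b by (simp add: power_mult)
  have binary: "?W a b \<in> binary_words (4 ^ k)" for a b
    using tensor_words_binary[of "2 * k"] by (simp add: power_mult)
  have skipped: "?W a False @ ?W a True \<in> ?P" for a
    using binary_words_append[OF binary[of a False] binary[of a True]] by (simp add: mult_2)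
  have "?W False False @ ?W False True @ ?W True False @ ?W True True
      \<in> conc (?R False False) (conc (?R False True) ?P) \<longleftrightarrow>
      ?W False False \<in> ?R False False \<and> ?W False True \<in> ?R False True"
    by (simp add: conc_append_iff[OF lang_tensor_regex_length len] skipped)
  moreover have "(?W False False @ ?W False True) @ ?W True False @ ?W True True
      \<in> conc ?P (conc (?R True False) (?R True True)) \<longleftrightarrow>
      ?W True False \<in> ?R True False \<and> ?W True True \<in> ?R True True"
    by (subst conc_append_iff[OF binary_words_length])
      (simp_all add: len skipped conc_append_iff[OF lang_tensor_regex_length len]
        del: length_tensor_words)
  ultimately show ?case
    unfolding tensor_words_slices p_alt_slices lang_tensor_regex_Suc
    by (simp add: Suc.IH all_bool_eq ex_bool_eq) blast
qed

lemma in_lang_OAPT_regex_iff: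
  "concat (map (tensor_words (2 * k)) vs) \<in> lang (OAPT_regex k us) \<longleftrightarrow>
     OAPT (2 * k) (set us) (set vs)"
proof -
  let ?P = "binary_words (4 ^ k)" and ?Y = "\<Union>u\<in>set us. lang (tensor_regex k u)"
  let ?W = "map (tensor_words (2 * k)) vs"
  have words: "set ?W \<subseteq> ?P"
    using tensor_words_binary[of "2 * k"] by (auto simp: power_mult)
  have "2 \<notin> set (concat ?W)"
    using words by (fastforce simp: binary_words_def)
  then have "concat ?W \<in> lang (OAPT_regex k us) \<longleftrightarrow> concat ?W \<in> conc (star ?P) (conc ?Y (star ?P))"
    by (simp add: OAPT_regex_def lang_foldl_RAlt lang_pad in_conc_insert_foreign_iff)
  also have "\<dots> \<longleftrightarrow> set ?W \<inter> ?Y \<noteq> {}"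
    using lang_tensor_regex_length words
    by (intro in_star_conc_star_iff[OF binary_words_length]) auto
  also have "\<dots> \<longleftrightarrow> OAPT (2 * k) (set us) (set vs)"
    unfolding OAPT_def tensor_words_in_lang_iff[symmetric] by auto
  finally show ?thesis .
qed

section \<open>Timed execution\<close>

definition runs :: "nat \<Rightarrow> prog \<Rightarrow> config \<Rightarrow> nat \<Rightarrow> (config \<Rightarrow> bool) \<Rightarrow> bool" where
  "runs w P s T Q \<longleftrightarrow> (\<exists>n s'. exec w P s n s' \<and> n \<le> T \<and> Q s')"

lemma runs_mono:
  "runs w P s T Q \<Longrightarrow> (\<And>s'. Q s' \<Longrightarrow> Q' s') \<Longrightarrow> T \<le> T' \<Longrightarrow> runs w P s T' Q'"
  unfolding runs_def by (meson le_trans)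

lemma runs_time: "runs w P s T Q \<Longrightarrow> T \<le> T' \<Longrightarrow> runs w P s T' Q"
  by (rule runs_mono)

lemma runs_Const: "k < 2 ^ w \<Longrightarrow> Q (r(x := k), m) \<Longrightarrow> runs w (Const x k) (r, m) 1 Q"
  unfolding runs_def using exec.Const[of w x k r m] by auto

lemma runs_Add: "r y + r z < 2 ^ w \<Longrightarrow> Q (r(x := r y + r z), m) \<Longrightarrow> runs w (Add x y z) (r, m) 1 Q"
  unfolding runs_def using exec.Add[of w x y z r m] by auto

lemma runs_Sub: "Q (r(x := r y - r z), m) \<Longrightarrow> runs w (Sub x y z) (r, m) 1 Q"
  unfolding runs_def using exec.Sub[of w x y z r m] by auto

lemma runs_Load: "Q (r(x := m (r y)), m) \<Longrightarrow> runs w (Load x y) (r, m) 1 Q"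
  unfolding runs_def using exec.Load[of w x y r m] by auto

lemma runs_Store: "Q (r, m(r x := r y)) \<Longrightarrow> runs w (Store x y) (r, m) 1 Q"
  unfolding runs_def using exec.Store[of w x y r m] by auto

lemma runs_Seq: "runs w P s T (\<lambda>s'. runs w P' s' T' Q) \<Longrightarrow> runs w (Seq P P') s (T + T') Q"
  unfolding runs_def by (meson add_mono exec.Seq)

lemma runs_Seq_intermediate:
  "runs w P s T R \<Longrightarrow> (\<And>s'. R s' \<Longrightarrow> runs w P' s' T' Q) \<Longrightarrow> runs w (Seq P P') s (T + T') Q"
  by (rule runs_Seq) (erule runs_mono, auto)

lemma runs_While_exit:
  "\<not> fst s x < fst s y \<Longrightarrow> Q s \<Longrightarrow> runs w (WhileLess x y P) s 1 Q"
  unfolding runs_def by (metis exec.WhileFalse order_refl prod.collapse)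

lemma runs_While_step:
  assumes "fst s x < fst s y" and "runs w P s T (\<lambda>s'. runs w (WhileLess x y P) s' T' Q)"
  shows "runs w (WhileLess x y P) s (1 + T + T') Q"
proof -
  from assms(2) obtain n s' n' s'' where "exec w P s n s'" "exec w (WhileLess x y P) s' n' s''"
    and "n \<le> T" "n' \<le> T'" "Q s''"
    unfolding runs_def by blast
  with assms(1) have "exec w (WhileLess x y P) s (1 + n + n') s''"
    by (metis exec.WhileTrue prod.collapse)
  moreover have "1 + n + n' \<le> 1 + T + T'"
    using \<open>n \<le> T\<close> \<open>n' \<le> T'\<close> by simp
  ultimately show ?thesis using \<open>Q s''\<close> unfolding runs_def by blast
qed

fun block :: "prog list \<Rightarrow> prog" where
  "block [P] = P"
| "block (P # P' # Ps) = Seq P (block (P' # Ps))"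

section \<open>The memory as an append-only tape\<close>

text \<open>
  Registers 0 to 3 are fixed by the input and output conventions.  The words between
  \<open>head_reg\<close> and \<open>limit_reg\<close> are being copied, those between \<open>head_reg\<close> and \<open>stop_reg\<close> are the
  unread rest of the current level; \<open>width_reg\<close> and \<open>padding_reg\<close> hold the written lengths of its
  expressions and of the padding.
\<close>

abbreviation (input) count_reg :: nat where "count_reg \<equiv> 0"
abbreviation (input) order_reg :: nat where "order_reg \<equiv> 1"
abbreviation (input) size_reg :: nat where "size_reg \<equiv> 3"
abbreviation (input) one_reg :: nat where "one_reg \<equiv> 4"
abbreviation (input) zero_reg :: nat where "zero_reg \<equiv> 5"
abbreviation (input) free_reg :: nat where "free_reg \<equiv> 6"
abbreviation (input) head_reg :: nat where "head_reg \<equiv> 7"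
abbreviation (input) scratch_reg :: nat where "scratch_reg \<equiv> 8"
abbreviation (input) limit_reg :: nat where "limit_reg \<equiv> 9"
abbreviation (input) stop_reg :: nat where "stop_reg \<equiv> 10"
abbreviation (input) width_reg :: nat where "width_reg \<equiv> 11"
abbreviation (input) padding_reg :: nat where "padding_reg \<equiv> 12"
abbreviation (input) full_padding_reg :: nat where "full_padding_reg \<equiv> 13"

definition memory :: "nat list \<Rightarrow> nat \<Rightarrow> nat" where
  "memory ms = (\<lambda>k. if k < length ms then ms ! k else 0)"

lemma memory_append: "p = length ms \<Longrightarrow> (memory ms)(p := x) = memory (ms @ [x])"
  by (auto simp: memory_def nth_append fun_eq_iff)

lemma memory_nth: "memory (pre @ x # post) (length pre) = x"
  by (simp add: memory_def)

lemma stored_at_memory: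
  "length (pre @ ws) \<le> 2 ^ w \<Longrightarrow> stored_at w (memory (pre @ ws @ post)) (length pre) ws"
  by (simp add: stored_at_def memory_def nth_append)

text \<open>
  A word is only ever stored at the end of the written memory, so that a growing list
  describes it.  The registers in \<open>V\<close> are work space.
\<close>

definition tape :: "nat set \<Rightarrow> (nat \<Rightarrow> nat) \<Rightarrow> nat \<Rightarrow> nat list \<Rightarrow> config \<Rightarrow> bool" where
  "tape V r p ms s \<longleftrightarrow>
     (\<exists>q. s = (q, memory ms) \<and> q free_reg = length ms \<and> q head_reg = p \<and>
       (\<forall>y. y \<notin> V \<union> {free_reg, head_reg} \<longrightarrow> q y = r y))"

lemma tape_mono:
  "tape V q p ms s \<Longrightarrow> V \<subseteq> V' \<Longrightarrow> (\<And>y. y \<notin> V' \<union> {free_reg, head_reg} \<Longrightarrow> q y = r y) \<Longrightarrow> tape V' r p ms s"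
  unfolding tape_def by fastforce

text \<open>
  The program reads \<open>xs\<close> and appends \<open>ys\<close>, taking time \<open>c\<close> per appended word.  The time of the
  reduction is thus bounded by the amount of memory that it fills.
\<close>

definition transduces ::
  "nat \<Rightarrow> nat set \<Rightarrow> nat \<Rightarrow> (nat \<Rightarrow> nat) \<Rightarrow> prog \<Rightarrow> nat list \<Rightarrow> nat list \<Rightarrow> bool" where
  "transduces w V c r P xs ys \<longleftrightarrow>
     (\<forall>pre post s. tape V r (length pre) (pre @ xs @ post) s \<and>
        length (pre @ xs @ post @ ys) < 2 ^ w \<longrightarrow>
        runs w P s (c * length ys) (tape V r (length (pre @ xs)) (pre @ xs @ post @ ys)))"

lemma transducesI:
  assumes "\<And>pre post q. \<lbrakk>q free_reg = length (pre @ xs @ post); q head_reg = length pre;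
      \<forall>y. y \<notin> V \<union> {free_reg, head_reg} \<longrightarrow> q y = r y; length (pre @ xs @ post @ ys) < 2 ^ w\<rbrakk> \<Longrightarrow>
    runs w P (q, memory (pre @ xs @ post)) (c * length ys)
      (tape V r (length (pre @ xs)) (pre @ xs @ post @ ys))"
  shows "transduces w V c r P xs ys"
  unfolding transduces_def using assms by (auto simp: tape_def)

lemma transducesD:
  "transduces w V c r P xs ys \<Longrightarrow> tape V r (length pre) (pre @ xs @ post) s \<Longrightarrow>
     length (pre @ xs @ post @ ys) < 2 ^ w \<Longrightarrow>
     runs w P s (c * length ys) (tape V r (length (pre @ xs)) (pre @ xs @ post @ ys))"
  unfolding transduces_def by blast

lemma transduces_time: "transduces w V c r P xs ys \<Longrightarrow> c \<le> c' \<Longrightarrow> transduces w V c' r P xs ys"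
  unfolding transduces_def by (meson runs_time mult_le_mono1)

lemma transduces_Seq:
  assumes P: "transduces w V c r P xs ys" and P': "transduces w V c r P' xs' ys'"
  shows "transduces w V c r (Seq P P') (xs @ xs') (ys @ ys')"
  unfolding transduces_def
proof (intro allI impI, elim conjE)
  fix pre post s
  assume s: "tape V r (length pre) (pre @ (xs @ xs') @ post) s"
    and w: "length (pre @ (xs @ xs') @ post @ ys @ ys') < 2 ^ w"
  from s w have "runs w P s (c * length ys)
      (tape V r (length (pre @ xs)) (pre @ xs @ (xs' @ post) @ ys))"
    by (intro transducesD[OF P]) simp_all
  moreover have "runs w P' s' (c * length ys')
      (tape V r (length ((pre @ xs) @ xs')) ((pre @ xs) @ xs' @ (post @ ys) @ ys'))"
    if "tape V r (length (pre @ xs)) (pre @ xs @ (xs' @ post) @ ys) s'" for s'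
    using that w by (intro transducesD[OF P']) simp_all
  ultimately have "runs w (Seq P P') s (c * length ys + c * length ys')
      (tape V r (length ((pre @ xs) @ xs')) ((pre @ xs) @ xs' @ (post @ ys) @ ys'))"
    by (rule runs_Seq_intermediate)
  then show "runs w (Seq P P') s (c * length (ys @ ys'))
      (tape V r (length (pre @ xs @ xs')) (pre @ (xs @ xs') @ post @ ys @ ys'))"
    by (simp add: distrib_left)
qed

lemma runs_While_transduces:
  assumes P: "\<And>u. u \<in> set us \<Longrightarrow> transduces w V c r P (f u) (g u)"
    and guard: "\<And>us1 us2 s. us = us1 @ us2 \<Longrightarrow>
      tape V r (length (pre @ concat (map f us1)))
        (pre @ concat (map f us) @ post @ concat (map g us1)) s \<Longrightarrow>
      fst s x < fst s y \<longleftrightarrow> us2 \<noteq> []"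
    and s: "tape V r (length pre) (pre @ concat (map f us) @ post) s"
    and w: "length (pre @ concat (map f us) @ post @ concat (map g us)) < 2 ^ w"
  shows "runs w (WhileLess x y P) s (c * length (concat (map g us)) + length us + 1)
    (tape V r (length (pre @ concat (map f us)))
      (pre @ concat (map f us) @ post @ concat (map g us)))"
  using assms
proof (induction us arbitrary: pre post s)
  case Nil
  have "\<not> fst s x < fst s y" using Nil.prems(2)[of "[]" "[]" s] Nil.prems(3) by simp
  then show ?case using runs_While_exit[of s x y _ w P] Nil.prems(3) by simp
next
  case (Cons u us)
  let ?X = "concat (map f us)" and ?Y = "concat (map g us)"
  have body: "runs w P s (c * length (g u))
      (tape V r (length (pre @ f u)) (pre @ f u @ (?X @ post) @ g u))"
    using Cons.prems by (intro transducesD[OF Cons.prems(1)]) simp_all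
  have rest: "runs w (WhileLess x y P) s' (c * length ?Y + length us + 1)
      (tape V r (length ((pre @ f u) @ ?X)) ((pre @ f u) @ ?X @ (post @ g u) @ ?Y))"
    if "tape V r (length (pre @ f u)) (pre @ f u @ (?X @ post) @ g u) s'" for s'
  proof (rule Cons.IH)
    fix us1 us2 s''
    assume "us = us1 @ us2" and "tape V r (length ((pre @ f u) @ concat (map f us1)))
      ((pre @ f u) @ ?X @ (post @ g u) @ concat (map g us1)) s''"
    then show "fst s'' x < fst s'' y \<longleftrightarrow> us2 \<noteq> []"
      using Cons.prems(2)[of "u # us1" us2 s''] by simp
  qed (use Cons.prems that in simp_all)
  have "fst s x < fst s y"
    using Cons.prems(2)[of "[]" "u # us" s] Cons.prems(3) by simp
  then have "runs w (WhileLess x y P) s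
      (1 + c * length (g u) + (c * length ?Y + length us + 1))
      (tape V r (length ((pre @ f u) @ ?X)) ((pre @ f u) @ ?X @ (post @ g u) @ ?Y))"
    by (rule runs_While_step) (rule runs_mono[OF body rest order_refl])
  then show ?case by (simp add: algebra_simps)
qed

lemma length_le_length_concat_map:
  "(\<And>u. u \<in> set us \<Longrightarrow> f u \<noteq> []) \<Longrightarrow> length us \<le> length (concat (map f us))"
proof (induction us)
  case (Cons u us)
  then show ?case by (cases "f u") auto
qed simp

lemma runs_While_head_transduces:
  assumes P: "\<And>u. u \<in> set us \<Longrightarrow> transduces w V c r P (f u) (g u)"
    and nonempty: "\<And>u. u \<in> set us \<Longrightarrow> f u \<noteq> [] \<and> g u \<noteq> []"
    and y: "y \<notin> V \<union> {free_reg, head_reg}" "r y = length (pre @ concat (map f us))"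
    and s: "tape V r (length pre) (pre @ concat (map f us) @ post) s"
    and w: "length (pre @ concat (map f us) @ post @ concat (map g us)) < 2 ^ w"
  shows "runs w (WhileLess head_reg y P) s (Suc c * length (concat (map g us)) + 1)
    (tape V r (length (pre @ concat (map f us)))
      (pre @ concat (map f us) @ post @ concat (map g us)))"
proof (rule runs_time[OF runs_While_transduces[OF P _ s w]])
  fix us1 us2 s'
  assume us: "us = us1 @ us2" and s': "tape V r (length (pre @ concat (map f us1)))
      (pre @ concat (map f us) @ post @ concat (map g us1)) s'"
  from s' y have "fst s' head_reg < fst s' y \<longleftrightarrow> 0 < length (concat (map f us2))"
    unfolding tape_def us by auto
  also have "\<dots> \<longleftrightarrow> us2 \<noteq> []"
    using nonempty us by (cases us2) auto
  finally show "fst s' head_reg < fst s' y \<longleftrightarrow> us2 \<noteq> []" .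
qed (use nonempty in \<open>auto intro!: length_le_length_concat_map\<close>)

section \<open>Writing and copying words\<close>

abbreviation (input) work_regs :: "nat set" where
  "work_regs \<equiv> {scratch_reg, limit_reg}"

definition emit_word :: "nat \<Rightarrow> prog" where
  "emit_word k =
     block [Const scratch_reg k, Store free_reg scratch_reg, Add free_reg free_reg one_reg]"

definition emit_tokens :: "nat token list \<Rightarrow> prog" where
  "emit_tokens xs = block (map (\<lambda>x. emit_word (token_word x)) xs)"

definition fill :: "nat \<Rightarrow> nat token list \<Rightarrow> prog" where
  "fill n xs = block [Add limit_reg free_reg n, WhileLess free_reg limit_reg (emit_tokens xs)]"

definition copy_word :: prog where
  "copy_word = block [Load scratch_reg head_reg, Store free_reg scratch_reg,
     Add free_reg free_reg one_reg, Add head_reg head_reg one_reg]"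

definition copy :: "nat \<Rightarrow> prog" where
  "copy n = block [Add limit_reg head_reg n, WhileLess head_reg limit_reg copy_word]"

lemma transduces_emit_word:
  assumes "scratch_reg \<in> V" "one_reg \<notin> V" "r one_reg = 1" "k < 2 ^ w"
  shows "transduces w V 3 r (emit_word k) [] [k]"
proof (rule transducesI)
  fix pre post q
  assume "q free_reg = length (pre @ [] @ post)" "q head_reg = length pre"
    "\<forall>y. y \<notin> V \<union> {free_reg, head_reg} \<longrightarrow> q y = r y" "length (pre @ [] @ post @ [k]) < 2 ^ w"
  with assms have "runs w (emit_word k) (q, memory (pre @ [] @ post)) (1 + (1 + 1))
      (tape V r (length (pre @ [])) (pre @ [] @ post @ [k]))"
    unfolding emit_word_def block.simps
    by (intro runs_Seq runs_Const runs_Store runs_Add)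
      (auto simp: tape_def memory_append)
  then show "runs w (emit_word k) (q, memory (pre @ [] @ post)) (3 * length [k])
      (tape V r (length (pre @ [])) (pre @ [] @ post @ [k]))" by (rule runs_time) simp
qed

lemma transduces_emit_tokens:
  assumes "xs \<noteq> []" "\<forall>x\<in>set xs. token_word x < 2 ^ w"
    and "scratch_reg \<in> V" "one_reg \<notin> V" "r one_reg = 1" "3 \<le> c"
  shows "transduces w V c r (emit_tokens xs) [] (map token_word xs)"
proof -
  have "transduces w V 3 r (emit_tokens xs) [] (map token_word xs)"
    using assms(1,2)
  proof (induction xs rule: list_nonempty_induct)
    case (single x)
    then show ?case
      unfolding emit_tokens_def using transduces_emit_word[of V r "token_word x" w] assms by simp
  next
    case (cons x xs)
    then have "transduces w V 3 r (Seq (emit_word (token_word x)) (emit_tokens xs))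
        ([] @ []) ([token_word x] @ map token_word xs)"
      by (intro transduces_Seq transduces_emit_word) (use assms in auto)
    moreover have "emit_tokens (x # xs) = Seq (emit_word (token_word x)) (emit_tokens xs)"
      using \<open>xs \<noteq> []\<close> by (cases xs) (simp_all add: emit_tokens_def)
    ultimately show ?case by simp
  qed
  then show ?thesis using \<open>3 \<le> c\<close> by (rule transduces_time)
qed

lemma length_concat_map_const: "length (concat (map (\<lambda>_. ys) us)) = length us * length ys"
  by (induction us) simp_all

lemma runs_While_free_emit_tokens:
  fixes pre post :: "nat list" and xs h
  defines "ys \<equiv> concat (replicate h (map token_word xs))"
  assumes xs: "xs \<noteq> []" "\<forall>x\<in>set xs. token_word x < 2 ^ w"
    and V: "scratch_reg \<in> V" "one_reg \<notin> V" "r one_reg = 1"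
    and y: "y \<notin> V \<union> {free_reg, head_reg}" "r y = length (pre @ post @ ys)"
    and s: "tape V r (length pre) (pre @ post) s" and w: "length (pre @ post @ ys) < 2 ^ w"
  shows "runs w (WhileLess free_reg y (emit_tokens xs)) s (3 * length ys + h + 1)
    (tape V r (length pre) (pre @ post @ ys))"
proof -
  let ?us = "replicate h ()" and ?nil = "\<lambda>_ :: unit. [] :: nat list"
    and ?g = "\<lambda>_ :: unit. map token_word xs"
  have ys: "ys = concat (map ?g ?us)" by (simp add: ys_def)
  have "runs w (WhileLess free_reg y (emit_tokens xs)) s
      (3 * length (concat (map ?g ?us)) + length ?us + 1)
      (tape V r (length (pre @ concat (map ?nil ?us)))
        (pre @ concat (map ?nil ?us) @ post @ concat (map ?g ?us)))"
  proof (rule runs_While_transduces)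
    show "transduces w V 3 r (emit_tokens xs) [] (map token_word xs)"
      using xs V by (intro transduces_emit_tokens) auto
    show "fst s' free_reg < fst s' y \<longleftrightarrow> us2 \<noteq> []"
      if us: "?us = us1 @ us2" and "tape V r (length (pre @ concat (map ?nil us1)))
        (pre @ concat (map ?nil ?us) @ post @ concat (map ?g us1)) s'" for us1 us2 s'
      using that xs(1) y unfolding tape_def ys us by (auto simp: length_concat_map_const)
  qed (use s w ys in simp_all)
  then show ?thesis by (simp add: ys)
qed

lemma transduces_fill:
  assumes xs: "xs \<noteq> []" "\<forall>x\<in>set xs. token_word x < 2 ^ w"
    and n: "r n = h * length xs" "0 < h" "n \<notin> work_regs \<union> {free_reg, head_reg}"
    and one: "r one_reg = 1"
  shows "transduces w work_regs 7 r (fill n xs) [] (concat (replicate h (map token_word xs)))"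
proof (rule transducesI)
  fix pre post q
  let ?ys = "concat (replicate h (map token_word xs))"
  let ?r = "q(limit_reg := length (pre @ post @ ?ys))"
  assume q: "q free_reg = length (pre @ [] @ post)" "q head_reg = length pre"
      "\<forall>y. y \<notin> work_regs \<union> {free_reg, head_reg} \<longrightarrow> q y = r y"
    and w: "length (pre @ [] @ post @ ?ys) < 2 ^ w"
  have len: "length ?ys = h * length xs"
    by (simp add: length_concat sum_list_replicate)
  have "runs w (WhileLess free_reg limit_reg (emit_tokens xs)) (?r, memory (pre @ post))
      (3 * length ?ys + h + 1) (tape {scratch_reg} ?r (length pre) (pre @ post @ ?ys))"
    by (rule runs_While_free_emit_tokens) (use xs q w one in \<open>auto simp: tape_def\<close>)
  then have "runs w (WhileLess free_reg limit_reg (emit_tokens xs)) (?r, memory (pre @ post))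
      (3 * length ?ys + h + 1) (tape work_regs r (length pre) (pre @ post @ ?ys))"
    by (rule runs_mono) (use q in \<open>auto elim!: tape_mono split: if_splits\<close>)
  with q w n len have "runs w (fill n xs) (q, memory (pre @ [] @ post)) (1 + (3 * length ?ys + h + 1))
      (tape work_regs r (length (pre @ [])) (pre @ [] @ post @ ?ys))"
    unfolding fill_def block.simps by (intro runs_Seq runs_Add) (simp_all add: add.assoc)
  moreover have "h \<le> h * length xs"
    using xs(1) by (cases xs) simp_all
  ultimately show "runs w (fill n xs) (q, memory (pre @ [] @ post)) (7 * length ?ys)
      (tape work_regs r (length (pre @ [])) (pre @ [] @ post @ ?ys))"
    by (elim runs_time) (use n(2) len in linarith)
qed

lemma transduces_copy_word:
  assumes "scratch_reg \<in> V" "one_reg \<notin> V" "r one_reg = 1"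
  shows "transduces w V 4 r copy_word [x] [x]"
proof (rule transducesI)
  fix pre post q
  assume "q free_reg = length (pre @ [x] @ post)" "q head_reg = length pre"
    "\<forall>y. y \<notin> V \<union> {free_reg, head_reg} \<longrightarrow> q y = r y" "length (pre @ [x] @ post @ [x]) < 2 ^ w"
  with assms have "runs w copy_word (q, memory (pre @ [x] @ post)) (1 + (1 + (1 + 1)))
      (tape V r (length (pre @ [x])) (pre @ [x] @ post @ [x]))"
    unfolding copy_word_def block.simps
    by (intro runs_Seq runs_Load runs_Store runs_Add)
      (auto simp: tape_def memory_append memory_nth)
  then show "runs w copy_word (q, memory (pre @ [x] @ post)) (4 * length [x])
      (tape V r (length (pre @ [x])) (pre @ [x] @ post @ [x]))" by (rule runs_time) simp
qed

text \<open>The constant 7 is attained for a single word.\<close>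

lemma transduces_copy:
  assumes n: "r n = length xs" "xs \<noteq> []" "n \<notin> work_regs \<union> {free_reg, head_reg}"
    and one: "r one_reg = 1"
  shows "transduces w work_regs 7 r (copy n) xs xs"
proof (rule transducesI)
  fix pre post q
  let ?r = "q(limit_reg := length (pre @ xs))" and ?f = "\<lambda>x. [x]"
  assume q: "q free_reg = length (pre @ xs @ post)" "q head_reg = length pre"
      "\<forall>y. y \<notin> work_regs \<union> {free_reg, head_reg} \<longrightarrow> q y = r y"
    and w: "length (pre @ xs @ post @ xs) < 2 ^ w"
  have loop: "runs w (WhileLess head_reg limit_reg copy_word) (?r, memory (pre @ xs @ post))
      (Suc 4 * length (concat (map ?f xs)) + 1)
      (tape {scratch_reg} ?r (length (pre @ concat (map ?f xs)))
        (pre @ concat (map ?f xs) @ post @ concat (map ?f xs)))"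
    by (rule runs_While_head_transduces, rule transduces_copy_word)
      (use q w one in \<open>auto simp: tape_def\<close>)
  have "runs w (WhileLess head_reg limit_reg copy_word) (?r, memory (pre @ xs @ post))
      (5 * length xs + 1) (tape work_regs r (length (pre @ xs)) (pre @ xs @ post @ xs))"
    by (rule runs_mono[OF loop]) (use q in \<open>auto elim!: tape_mono split: if_splits\<close>)
  with q w n have "runs w (copy n) (q, memory (pre @ xs @ post)) (1 + (5 * length xs + 1))
      (tape work_regs r (length (pre @ xs)) (pre @ xs @ post @ xs))"
    unfolding copy_def block.simps by (intro runs_Seq runs_Add) simp_all
  then show "runs w (copy n) (q, memory (pre @ xs @ post)) (7 * length xs)
      (tape work_regs r (length (pre @ xs)) (pre @ xs @ post @ xs))"
    by (rule runs_time) (use n(2) in \<open>cases xs, auto\<close>)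
qed

section \<open>Written forms\<close>

definition tokens :: "nat regex \<Rightarrow> nat list" where
  "tokens R = map token_word (written R)"

lemma tokens_simps [simp]:
  "tokens (RSym a) = [a + 5]"
  "tokens (RCat R S) = tokens R @ tokens S"
  "tokens (RAlt R S) = 0 # tokens R @ 1 # tokens S @ [2]"
  "tokens (RStar R) = 0 # tokens R @ [2, 4]"
  by (simp_all add: tokens_def)

lemma tokens_nonempty [simp]: "tokens R \<noteq> []"
  by (induction R) (simp_all add: tokens_def)

lemma tokens_cat: "rs \<noteq> [] \<Longrightarrow> tokens (cat rs) = concat (map tokens rs)"
  by (induction rs rule: cat.induct) simp_all

lemma tokens_foldl_RAlt:
  "tokens (foldl RAlt r rs) =
     replicate (length rs) 0 @ tokens r @ concat (map (\<lambda>r. 1 # tokens r @ [2]) rs)"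
  by (induction rs arbitrary: r) (simp_all add: replicate_app_Cons_same)

lemma tokens_pad: "0 < h \<Longrightarrow> tokens (pad h) = concat (replicate h (tokens (leaf False)))"
  by (simp add: pad_def tokens_cat)

lemma length_tokens_pad: "0 < h \<Longrightarrow> length (tokens (pad h)) = 5 * h"
  by (simp add: tokens_pad leaf_def length_concat sum_list_replicate)

lemma tokens_tensor_regex_Suc:
  "tokens (tensor_regex (Suc k) u) =
     [0] @ (tokens (tensor_regex k (slice u False False)) @
       tokens (tensor_regex k (slice u False True))) @ tokens (pad (2 * 4 ^ k)) @
     [1] @ tokens (pad (2 * 4 ^ k)) @ (tokens (tensor_regex k (slice u True False)) @
       tokens (tensor_regex k (slice u True True))) @ [2]"
  by simp

text \<open>The solution of the recursion \<open>node_length_Suc\<close> below.\<close>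

definition node_length :: "nat \<Rightarrow> nat" where
  "node_length k = (5 * k + 6) * 4 ^ k - 1"

lemma Suc_node_length: "Suc (node_length k) = (5 * k + 6) * 4 ^ k"
  by (simp add: node_length_def)

lemma node_length_Suc: "node_length (Suc k) = 4 * node_length k + 20 * 4 ^ k + 3"
  using Suc_node_length[of k] Suc_node_length[of "Suc k"] by (simp add: algebra_simps)

lemma length_tokens_tensor_regex [simp]: "length (tokens (tensor_regex k u)) = node_length k"
proof (induction k arbitrary: u)
  case 0
  show ?case by (simp add: leaf_def node_length_def)
next
  case (Suc k)
  then show ?case
    unfolding tokens_tensor_regex_Suc by (simp add: length_tokens_pad node_length_Suc)
qed

text \<open>
  The token of a symbol \<open>a\<close> is the word \<open>a + 5\<close>, so \<open>6 - b\<close> is that of the complement of a bit \<open>b\<close>.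
\<close>

definition emit_complement :: prog where
  "emit_complement = block [Const scratch_reg 6, Load limit_reg head_reg,
     Sub scratch_reg scratch_reg limit_reg, Store free_reg scratch_reg,
     Add free_reg free_reg one_reg, Add head_reg head_reg one_reg]"

definition emit_leaf :: prog where
  "emit_leaf = block [emit_tokens [TOpen, TSym 0, TBar], emit_complement, emit_tokens [TClose]]"

definition emit_pad :: prog where
  "emit_pad = fill padding_reg (written (leaf False))"

definition emit_node :: prog where
  "emit_node = block [emit_tokens [TOpen], block [copy width_reg, copy width_reg], emit_pad,
     emit_tokens [TBar], emit_pad, block [copy width_reg, copy width_reg], emit_tokens [TClose]]"

definition emit_star :: prog where
  "emit_star = block [emit_tokens [TOpen], emit_pad, emit_tokens [TClose, TStar]]"

definition emit_choice :: prog where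
  "emit_choice = block [emit_tokens [TBar], copy width_reg, emit_tokens [TClose]]"

lemma transduces_emit_complement:
  assumes "r one_reg = 1" "7 < (2::nat) ^ w"
  shows "transduces w work_regs 7 r emit_complement
    [of_bool b] [token_word (TSym (if b then 0 else 1))]"
proof (rule transducesI)
  fix pre post q
  let ?y = "token_word (TSym (if b then 0 else 1))"
  assume "q free_reg = length (pre @ [of_bool b] @ post)" "q head_reg = length pre"
    "\<forall>y. y \<notin> work_regs \<union> {free_reg, head_reg} \<longrightarrow> q y = r y"
    "length (pre @ [of_bool b] @ post @ [?y]) < 2 ^ w"
  with assms have "runs w emit_complement (q, memory (pre @ [of_bool b] @ post))
      (1 + (1 + (1 + (1 + (1 + 1)))))
      (tape work_regs r (length (pre @ [of_bool b])) (pre @ [of_bool b] @ post @ [?y]))"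
    unfolding emit_complement_def block.simps
    by (intro runs_Seq runs_Const runs_Load runs_Sub runs_Store runs_Add)
      (auto simp: tape_def memory_append memory_nth)
  then show "runs w emit_complement (q, memory (pre @ [of_bool b] @ post)) (7 * length [?y])
      (tape work_regs r (length (pre @ [of_bool b])) (pre @ [of_bool b] @ post @ [?y]))"
    by (rule runs_time) simp
qed

lemma transduces_emit_leaf:
  assumes "r one_reg = 1" "7 < (2::nat) ^ w"
  shows "transduces w work_regs 7 r emit_leaf [of_bool b] (tokens (leaf b))"
proof -
  have "transduces w work_regs 7 r emit_leaf ([] @ [of_bool b] @ [])
      (map token_word [TOpen, TSym 0, TBar] @ [token_word (TSym (if b then 0 else 1))] @
       map token_word [TClose])"
    unfolding emit_leaf_def block.simps
    by (intro transduces_Seq transduces_emit_tokens transduces_emit_complement) (use assms in auto)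
  then show ?thesis by (simp add: leaf_def)
qed

lemma transduces_emit_pad:
  assumes "r one_reg = 1" "r padding_reg = 5 * h" "0 < h" "7 < (2::nat) ^ w"
  shows "transduces w work_regs 7 r emit_pad [] (tokens (pad h))"
proof -
  have "transduces w work_regs 7 r emit_pad []
      (concat (replicate h (map token_word (written (leaf False)))))"
    unfolding emit_pad_def by (intro transduces_fill) (use assms in \<open>auto simp: leaf_def\<close>)
  then show ?thesis unfolding tokens_pad[OF \<open>0 < h\<close>] unfolding tokens_def .
qed

lemma transduces_emit_star:
  assumes "r one_reg = 1" "r padding_reg = 5 * h" "0 < h" "7 < (2::nat) ^ w"
  shows "transduces w work_regs 7 r emit_star [] (tokens (RStar (pad h)))"
proof -
  have "transduces w work_regs 7 r emit_star ([] @ [] @ [])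
      (map token_word [TOpen] @ tokens (pad h) @ map token_word [TClose, TStar])"
    unfolding emit_star_def block.simps
    by (intro transduces_Seq transduces_emit_tokens transduces_emit_pad) (use assms in auto)
  then show ?thesis by simp
qed

lemma transduces_copy_tensor_regex:
  assumes "r one_reg = 1" "r width_reg = node_length k"
  shows "transduces w work_regs 7 r (copy width_reg)
    (tokens (tensor_regex k u)) (tokens (tensor_regex k u))"
  by (rule transduces_copy) (use assms in auto)

lemma transduces_emit_choice:
  assumes "r one_reg = 1" "r width_reg = node_length k" "7 < (2::nat) ^ w"
  shows "transduces w work_regs 7 r emit_choice
    (tokens (tensor_regex k u)) (1 # tokens (tensor_regex k u) @ [2])"
proof -
  have "transduces w work_regs 7 r emit_choice ([] @ tokens (tensor_regex k u) @ [])
      (map token_word [TBar] @ tokens (tensor_regex k u) @ map token_word [TClose])"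
    unfolding emit_choice_def block.simps
    by (intro transduces_Seq transduces_emit_tokens transduces_copy_tensor_regex)
      (use assms in auto)
  then show ?thesis by simp
qed

section \<open>The levels of subexpressions\<close>

definition quarters :: "(bool list \<Rightarrow> bool) list \<Rightarrow> (bool list \<Rightarrow> bool) list" where
  "quarters us = concat (map (\<lambda>u. [slice u False False, slice u False True,
                                   slice u True False, slice u True True]) us)"

definition level_words :: "nat \<Rightarrow> (bool list \<Rightarrow> bool) list \<Rightarrow> nat list" where
  "level_words k us = concat (map (\<lambda>u. tokens (tensor_regex k u)) us)"

text \<open>The words appended to level \<open>k\<close> until level \<open>k + d\<close> holds the expressions of \<open>us\<close>.\<close>

primrec levels :: "nat \<Rightarrow> nat \<Rightarrow> (bool list \<Rightarrow> bool) list \<Rightarrow> nat list" where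
  "levels k 0 us = []"
| "levels k (Suc d) us = level_words (Suc k) ((quarters ^^ d) us) @ levels (Suc k) d us"

lemma length_quarters [simp]: "length (quarters us) = 4 * length us"
  by (induction us) (simp_all add: quarters_def)

lemma length_funpow_quarters [simp]: "length ((quarters ^^ d) us) = 4 ^ d * length us"
  by (induction d) simp_all

lemma length_level_words [simp]: "length (level_words k us) = length us * node_length k"
  by (induction us) (simp_all add: level_words_def)

lemma tensor_words_quarters:
  "concat (map (tensor_words (2 * k)) us) = map (\<lambda>u. of_bool (u [])) ((quarters ^^ k) us)"
proof (induction k arbitrary: us)
  case 0
  show ?case by (induction us) (simp_all add: tensor_words_def)
next
  case (Suc k)
  have "concat (map (tensor_words (2 * Suc k)) us) =
      concat (map (tensor_words (2 * k)) (quarters us))"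
    unfolding tensor_words_slices by (induction us) (simp_all add: quarters_def)
  then show ?case by (simp only: Suc.IH funpow_Suc_right o_apply)
qed

lemma level_words_quarters:
  "level_words k (quarters us) = concat (map (\<lambda>u. level_words k (quarters [u])) us)"
  by (induction us) (simp_all add: level_words_def quarters_def)

lemma transduces_emit_node:
  assumes "r one_reg = 1" "r width_reg = node_length k" "r padding_reg = 10 * 4 ^ k"
    and "7 < (2::nat) ^ w"
  shows "transduces w work_regs 7 r emit_node
    (level_words k (quarters [u])) (tokens (tensor_regex (Suc k) u))"
proof -
  let ?T = "\<lambda>a b. tokens (tensor_regex k (slice u a b))" and ?P = "tokens (pad (2 * 4 ^ k))"
  have "transduces w work_regs 7 r emit_node
      ([] @ (?T False False @ ?T False True) @ [] @ [] @ [] @ (?T True False @ ?T True True) @ [])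
      (map token_word [TOpen] @ (?T False False @ ?T False True) @ ?P @ map token_word [TBar] @
       ?P @ (?T True False @ ?T True True) @ map token_word [TClose])"
    unfolding emit_node_def block.simps
    by (intro transduces_Seq transduces_emit_tokens transduces_emit_pad transduces_copy_tensor_regex)
      (use assms in auto)
  then show ?thesis
    unfolding tokens_tensor_regex_Suc by (simp add: level_words_def quarters_def)
qed

section \<open>The program\<close>

abbreviation (input) level_regs :: "nat set" where
  "level_regs \<equiv> {scratch_reg, limit_reg, stop_reg}"

definition parameters :: "nat \<Rightarrow> nat \<Rightarrow> nat \<Rightarrow> nat \<Rightarrow> nat" where
  "parameters N j k = (\<lambda>_. 0)(count_reg := N, order_reg := 2 * j, size_reg := N * 4 ^ j,
     one_reg := 1, width_reg := node_length k, padding_reg := 10 * 4 ^ k, full_padding_reg := 5 * 4 ^ j)"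

definition double_once :: prog where
  "double_once = block [Add size_reg size_reg size_reg,
     Add full_padding_reg full_padding_reg full_padding_reg, Add scratch_reg scratch_reg one_reg]"

definition double_sizes :: prog where
  "double_sizes = WhileLess scratch_reg order_reg double_once"

definition setup_registers :: prog where
  "setup_registers = block [Add size_reg count_reg zero_reg, Const one_reg 1,
     Const full_padding_reg 5, double_sizes, Const width_reg 5, Const padding_reg 10,
     Add free_reg size_reg size_reg]"

definition emit_leaves :: prog where
  "emit_leaves = block [WhileLess head_reg size_reg emit_leaf, Add head_reg size_reg size_reg]"

definition emit_level :: prog where
  "emit_level = block [Add stop_reg free_reg zero_reg, WhileLess head_reg stop_reg emit_node]"

definition next_level :: prog where
  "next_level = block [Add width_reg width_reg width_reg, Add width_reg width_reg width_reg,
     Add width_reg width_reg padding_reg, Add width_reg width_reg padding_reg,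
     Const scratch_reg 3, Add width_reg width_reg scratch_reg,
     Add padding_reg padding_reg padding_reg, Add padding_reg padding_reg padding_reg]"

definition emit_levels :: prog where
  "emit_levels = WhileLess padding_reg full_padding_reg (block [emit_level, next_level])"

definition emit_prefix :: prog where
  "emit_prefix = block [emit_star, fill count_reg [TOpen], emit_tokens [TSym 2]]"

definition emit_OAPT_regex :: prog where
  "emit_OAPT_regex = block [emit_prefix, WhileLess head_reg stop_reg emit_choice, emit_star]"

definition emit_output :: prog where
  "emit_output = block [Add stop_reg free_reg zero_reg, Add padding_reg full_padding_reg zero_reg,
     emit_OAPT_regex]"

definition return_registers :: prog where
  "return_registers =
     block [Sub 1 free_reg stop_reg, Add 0 stop_reg zero_reg, Add 2 size_reg zero_reg]"

definition emit_subexpressions :: prog where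
  "emit_subexpressions = block [setup_registers, emit_leaves, emit_levels]"

definition reduction :: prog where
  "reduction = block [emit_subexpressions, emit_output, return_registers]"

lemma runs_double_once:
  assumes "2 * q size_reg < 2 ^ w" "2 * q full_padding_reg < 2 ^ w" "Suc (q scratch_reg) < 2 ^ w"
    and "q one_reg = 1"
  shows "runs w double_once (q, m) 3
    (\<lambda>s. s = (q(size_reg := 2 * q size_reg, full_padding_reg := 2 * q full_padding_reg,
       scratch_reg := Suc (q scratch_reg)), m))"
proof -
  have "runs w double_once (q, m) (1 + (1 + 1))
      (\<lambda>s. s = (q(size_reg := 2 * q size_reg, full_padding_reg := 2 * q full_padding_reg,
         scratch_reg := Suc (q scratch_reg)), m))"
    unfolding double_once_def block.simps
    by (intro runs_Seq runs_Add) (use assms in \<open>simp_all add: mult_2\<close>)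
  then show ?thesis by (rule runs_time) simp
qed

lemma runs_double_sizes:
  assumes "q scratch_reg + n = q order_reg" "q one_reg = 1"
    and "q size_reg * 2 ^ n < 2 ^ w" "q full_padding_reg * 2 ^ n < 2 ^ w" "q order_reg < 2 ^ w"
  shows "runs w double_sizes (q, m) (4 * n + 1)
    (\<lambda>s. s = (q(size_reg := q size_reg * 2 ^ n, full_padding_reg := q full_padding_reg * 2 ^ n,
       scratch_reg := q order_reg), m))"
  using assms
proof (induction n arbitrary: q)
  case 0
  then show ?case unfolding double_sizes_def
    by (intro runs_time[OF runs_While_exit]) (auto simp: fun_eq_iff)
next
  case (Suc n)
  let ?q = "q(size_reg := 2 * q size_reg, full_padding_reg := 2 * q full_padding_reg,
    scratch_reg := Suc (q scratch_reg))"
  let ?Q = "\<lambda>s. s = (q(size_reg := q size_reg * 2 ^ Suc n,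
    full_padding_reg := q full_padding_reg * 2 ^ Suc n, scratch_reg := q order_reg), m)"
  have "2 * q size_reg < 2 ^ w"
    using Suc.prems(3) by (rule le_less_trans[rotated]) simp
  moreover have "2 * q full_padding_reg < 2 ^ w"
    using Suc.prems(4) by (rule le_less_trans[rotated]) simp
  ultimately have body: "runs w double_once (q, m) 3 (\<lambda>s. s = (?q, m))"
    using Suc.prems by (intro runs_double_once) simp_all
  have rest: "runs w double_sizes s (4 * n + 1) ?Q" if "s = (?q, m)" for s
    unfolding that
    by (rule runs_mono[OF Suc.IH]) (use Suc.prems in \<open>auto simp: algebra_simps fun_eq_iff\<close>)
  have "fst (q, m) scratch_reg < fst (q, m) order_reg" using Suc.prems by simp
  then have "runs w double_sizes (q, m) (1 + 3 + (4 * n + 1)) ?Q"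
    using runs_mono[OF body rest order_refl] unfolding double_sizes_def by (rule runs_While_step)
  then show ?case by (rule runs_time) simp
qed

lemma runs_setup_registers:
  assumes ms: "length ms = 2 * (N * 4 ^ j)"
    and w: "length ms < 2 ^ w" "5 * 4 ^ j < (2::nat) ^ w" "10 < (2::nat) ^ w" "2 * j < 2 ^ w"
  shows "runs w setup_registers ((\<lambda>_. 0)(0 := N, 1 := 2 * j), memory ms) (8 * j + 7)
    (tape work_regs (parameters N j 0) 0 ms)"
proof -
  let ?q = "(\<lambda>_. 0)(0 := N, 1 := 2 * j, size_reg := N, one_reg := 1, full_padding_reg := 5)"
  let ?q' = "?q(size_reg := N * 4 ^ j, full_padding_reg := 5 * 4 ^ j, scratch_reg := 2 * j)"
  have "N \<le> N * 4 ^ j" by simp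
  with ms w(1) have "N < 2 ^ w" by linarith
  have loop: "runs w double_sizes (?q, memory ms) (4 * (2 * j) + 1)
      (\<lambda>s. s = (?q', memory ms))"
    by (rule runs_mono[OF runs_double_sizes[where n = "2 * j"]])
      (use ms w in \<open>auto simp: power_mult\<close>)
  have "runs w (block [Const width_reg 5, Const padding_reg 10, Add free_reg size_reg size_reg])
      s (1 + (1 + 1)) (tape work_regs (parameters N j 0) 0 ms)"
    if "s = (?q', memory ms)" for s
    unfolding that block.simps
    by (intro runs_Seq runs_Const runs_Add)
      (use w ms in \<open>auto simp: tape_def parameters_def node_length_def\<close>)
  note rest = runs_mono[OF loop this order_refl]
  have "runs w setup_registers ((\<lambda>_. 0)(0 := N, 1 := 2 * j), memory ms)
      (1 + (1 + (1 + ((4 * (2 * j) + 1) + (1 + (1 + 1)))))) (tape work_regs (parameters N j 0) 0 ms)"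
    unfolding setup_registers_def block.simps
    by (intro runs_Seq runs_Const runs_Add)
      (use w \<open>N < 2 ^ w\<close> rest in \<open>auto simp: fun_upd_twist\<close>)
  then show ?thesis by (rule runs_time) simp
qed

lemma runs_emit_leaves:
  fixes us post defines "ws \<equiv> map (\<lambda>u. of_bool (u [])) us @ post"
  assumes s: "tape work_regs (parameters N j k) 0 ws s"
    and len: "length us = N * 4 ^ j" "length post = N * 4 ^ j"
    and w: "length (ws @ level_words 0 us) < 2 ^ w" "7 < (2::nat) ^ w"
  shows "runs w emit_leaves s (8 * length (level_words 0 us) + 2)
    (tape level_regs (parameters N j k) (length ws) (ws @ level_words 0 us))"
proof -
  let ?leaves = "concat (map (\<lambda>u. tokens (leaf (u []))) us)"
  let ?P = "parameters N j k" and ?w = "map (\<lambda>u. [of_bool (u []) :: nat]) us"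
  have ws: "ws = concat ?w @ post" by (simp add: ws_def)
  have leaves: "level_words 0 us = ?leaves" by (simp add: level_words_def)
  have "runs w (WhileLess head_reg size_reg emit_leaf) s (Suc 7 * length ?leaves + 1)
      (tape work_regs ?P (length ([] @ concat ?w)) ([] @ concat ?w @ post @ ?leaves))"
  proof (rule runs_While_head_transduces)
    show "transduces w work_regs 7 ?P emit_leaf [of_bool (u [])] (tokens (leaf (u [])))"
      for u :: "bool list \<Rightarrow> bool"
      by (rule transduces_emit_leaf) (use w in \<open>auto simp: parameters_def\<close>)
  qed (use s w len in \<open>auto simp: ws_def leaves[symmetric] parameters_def\<close>)
  moreover have "runs w (Add head_reg size_reg size_reg) s' 1
      (tape level_regs ?P (length ws) (ws @ level_words 0 us))"
    if tape: "tape work_regs ?P (length ([] @ concat ?w)) ([] @ concat ?w @ post @ ?leaves) s'" for s'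
  proof -
    obtain q where s': "s' = (q, memory (ws @ level_words 0 us))"
        and q: "q free_reg = length (ws @ level_words 0 us)"
        "\<forall>y. y \<notin> work_regs \<union> {free_reg, head_reg} \<longrightarrow> q y = ?P y"
      using tape unfolding tape_def ws leaves by auto
    show ?thesis unfolding s'
      by (rule runs_Add) (use q w len in \<open>auto simp: tape_def parameters_def ws_def\<close>)
  qed
  ultimately have "runs w emit_leaves s ((Suc 7 * length ?leaves + 1) + 1)
      (tape level_regs ?P (length ws) (ws @ level_words 0 us))"
    unfolding emit_leaves_def block.simps by (rule runs_Seq_intermediate)
  then show ?thesis by (simp add: leaves)
qed

lemma runs_emit_level:
  assumes s: "tape level_regs (parameters N j k) (length pre) (pre @ level_words k (quarters us)) s"
    and w: "length (pre @ level_words k (quarters us) @ level_words (Suc k) us) < 2 ^ w"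
      "7 < (2::nat) ^ w"
  shows "runs w emit_level s (8 * length (level_words (Suc k) us) + 2)
    (tape level_regs (parameters N j k) (length (pre @ level_words k (quarters us)))
      ((pre @ level_words k (quarters us)) @ level_words (Suc k) us))"
proof -
  let ?ms = "pre @ level_words k (quarters us)" and ?P = "parameters N j k"
  let ?r = "?P(stop_reg := length ?ms)"
  let ?X = "concat (map (\<lambda>u. level_words k (quarters [u])) us)"
    and ?Y = "concat (map (\<lambda>u. tokens (tensor_regex (Suc k) u)) us)"
  have X: "level_words k (quarters us) = ?X" by (rule level_words_quarters)
  have Y: "level_words (Suc k) us = ?Y" by (simp only: level_words_def)
  obtain q where sq: "s = (q, memory ?ms)" and q: "q free_reg = length ?ms" "q head_reg = length pre"
      "\<forall>y. y \<notin> level_regs \<union> {free_reg, head_reg} \<longrightarrow> q y = ?P y"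
    using s unfolding tape_def by blast
  have "runs w (WhileLess head_reg stop_reg emit_node) (q(stop_reg := length ?ms), memory ?ms)
      (Suc 7 * length ?Y + 1) (tape work_regs ?r (length (pre @ ?X)) (pre @ ?X @ [] @ ?Y))"
  proof (rule runs_While_head_transduces)
    show "transduces w work_regs 7 ?r emit_node
        (level_words k (quarters [u])) (tokens (tensor_regex (Suc k) u))" for u
      by (rule transduces_emit_node) (use w in \<open>simp_all add: parameters_def\<close>)
    show "level_words k (quarters [u]) \<noteq> [] \<and> tokens (tensor_regex (Suc k) u) \<noteq> []" for u
      by (simp add: level_words_def quarters_def)
  qed (use q w in \<open>auto simp: tape_def X[symmetric] Y[symmetric] simp del: tensor_regex.simps\<close>)
  then have "runs w (WhileLess head_reg stop_reg emit_node) (q(stop_reg := length ?ms), memory ?ms)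
      (Suc 7 * length ?Y + 1) (tape level_regs ?P (length ?ms) (?ms @ level_words (Suc k) us))"
    by (rule runs_mono) (auto simp: X Y elim!: tape_mono split: if_splits)
  then have "runs w emit_level s (1 + (Suc 7 * length ?Y + 1))
      (tape level_regs ?P (length ?ms) (?ms @ level_words (Suc k) us))"
    unfolding emit_level_def block.simps sq
    by (intro runs_Seq runs_Add) (use q w in \<open>simp_all add: parameters_def\<close>)
  then show ?thesis by (simp only: Y) simp
qed

lemma padding_le_node_length: "10 * 4 ^ Suc k \<le> node_length (Suc k)"
  using Suc_node_length[of "Suc k"] by (simp add: algebra_simps)

lemma runs_next_level:
  assumes "tape level_regs (parameters N j k) p ms s" "node_length (Suc k) < 2 ^ w"
  shows "runs w next_level s 8 (tape level_regs (parameters N j (Suc k)) p ms)"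
proof -
  obtain q where s: "s = (q, memory ms)" and q: "q free_reg = length ms" "q head_reg = p"
      "\<forall>y. y \<notin> level_regs \<union> {free_reg, head_reg} \<longrightarrow> q y = parameters N j k y"
    using assms(1) unfolding tape_def by blast
  have "runs w next_level s (1 + (1 + (1 + (1 + (1 + (1 + (1 + 1)))))))
      (tape level_regs (parameters N j (Suc k)) p ms)"
    unfolding next_level_def block.simps s
    by (intro runs_Seq runs_Const runs_Add)
      (use q assms(2) padding_le_node_length[of k] in
        \<open>auto simp: tape_def parameters_def node_length_Suc\<close>)
  then show ?thesis by (rule runs_time) simp
qed

lemma runs_emit_level_next_level:
  assumes s: "tape level_regs (parameters N j k) (length pre) (pre @ level_words k (quarters us)) s"
    and "us \<noteq> []"
    and w: "length (pre @ level_words k (quarters us) @ level_words (Suc k) us) < 2 ^ w"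
      "7 < (2::nat) ^ w"
  shows "runs w (block [emit_level, next_level]) s (8 * length (level_words (Suc k) us) + 10)
    (tape level_regs (parameters N j (Suc k)) (length (pre @ level_words k (quarters us)))
      ((pre @ level_words k (quarters us)) @ level_words (Suc k) us))"
proof -
  have "node_length (Suc k) \<le> length (level_words (Suc k) us)"
    using \<open>us \<noteq> []\<close> by (simp add: Suc_le_eq)
  then have "node_length (Suc k) < 2 ^ w"
    by (rule le_less_trans) (use w(1) in simp)
  then have "runs w (block [emit_level, next_level]) s
      ((8 * length (level_words (Suc k) us) + 2) + 8)
      (tape level_regs (parameters N j (Suc k)) (length (pre @ level_words k (quarters us)))
        ((pre @ level_words k (quarters us)) @ level_words (Suc k) us))"
    unfolding block.simps
    using runs_next_level by (blast intro: runs_Seq_intermediate[OF runs_emit_level[OF s w]])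
  then show ?thesis by (rule runs_time) simp
qed

lemma runs_emit_levels:
  assumes "tape level_regs (parameters N (k + d) k) (length pre)
      (pre @ level_words k ((quarters ^^ d) us)) s"
    and "us \<noteq> []" and "length (pre @ level_words k ((quarters ^^ d) us) @ levels k d us) < 2 ^ w"
    and "7 < (2::nat) ^ w"
  shows "runs w emit_levels s (8 * length (levels k d us) + 11 * d + 1)
    (\<lambda>s. \<exists>pre'. pre @ level_words k ((quarters ^^ d) us) @ levels k d us =
         pre' @ level_words (k + d) us \<and>
       tape level_regs (parameters N (k + d) (k + d)) (length pre') (pre' @ level_words (k + d) us) s)"
  using assms
proof (induction d arbitrary: k pre s)
  case 0
  then have "\<not> fst s padding_reg < fst s full_padding_reg"
    by (auto simp: tape_def parameters_def)
  then have "runs w emit_levels s 1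
      (tape level_regs (parameters N k k) (length pre) (pre @ level_words k us))"
    unfolding emit_levels_def by (rule runs_While_exit) (use "0.prems"(1) in simp)
  then show ?case by (rule runs_mono) auto
next
  case (Suc d)
  let ?us = "(quarters ^^ d) us" and ?P = "parameters N (Suc k + d)"
  let ?ms = "pre @ level_words k (quarters ?us)" and ?new = "level_words (Suc k) ?us"
  let ?Q = "\<lambda>s. \<exists>pre'. ?ms @ ?new @ levels (Suc k) d us = pre' @ level_words (Suc k + d) us \<and>
    tape level_regs (?P (Suc k + d)) (length pre') (pre' @ level_words (Suc k + d) us) s"
  have "(4::nat) ^ k \<le> 4 ^ (k + d)" by (simp add: power_increasing)
  then have "(4::nat) ^ k < 2 * 4 ^ (k + d)" by (simp add: less_le_trans[of _ "2 * 4 ^ k"])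
  with Suc.prems(1) have guard: "fst s padding_reg < fst s full_padding_reg"
    by (auto simp: tape_def parameters_def)
  have "?us \<noteq> []"
    using \<open>us \<noteq> []\<close> unfolding length_greater_0_conv[symmetric] length_funpow_quarters by simp
  then have body: "runs w (block [emit_level, next_level]) s (8 * length ?new + 10)
      (tape level_regs (?P (Suc k)) (length ?ms) (?ms @ ?new))"
    by (intro runs_emit_level_next_level) (use Suc.prems in simp_all)
  have rest: "runs w emit_levels s' (8 * length (levels (Suc k) d us) + 11 * d + 1) ?Q"
    if "tape level_regs (?P (Suc k)) (length ?ms) (?ms @ ?new) s'" for s'
    by (rule Suc.IH) (use that Suc.prems in simp_all)
  have "runs w emit_levels s
      (1 + (8 * length ?new + 10) + (8 * length (levels (Suc k) d us) + 11 * d + 1)) ?Q"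
    using guard runs_mono[OF body rest order_refl] unfolding emit_levels_def
    by (rule runs_While_step)
  then show ?case by (rule runs_mono) simp_all
qed

lemma tokens_OAPT_regex:
  "tokens (OAPT_regex k us) =
     (tokens (RStar (pad (4 ^ k))) @ replicate (length us) 0 @ [7]) @
     concat (map (\<lambda>u. 1 # tokens (tensor_regex k u) @ [2]) us) @ tokens (RStar (pad (4 ^ k)))"
  by (simp add: OAPT_regex_def tokens_foldl_RAlt comp_def)

lemma transduces_emit_prefix:
  assumes "r one_reg = 1" "r padding_reg = 5 * h" "0 < h" "r count_reg = n" "0 < n"
    and "7 < (2::nat) ^ w"
  shows "transduces w work_regs 7 r emit_prefix [] (tokens (RStar (pad h)) @ replicate n 0 @ [7])"
proof -
  have "transduces w work_regs 7 r emit_prefix ([] @ [] @ [])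
      (tokens (RStar (pad h)) @ concat (replicate n (map token_word [TOpen])) @
       map token_word [TSym 2])"
    unfolding emit_prefix_def block.simps
    by (intro transduces_Seq transduces_emit_star transduces_fill transduces_emit_tokens)
      (use assms in auto)
  moreover have "concat (replicate n [0]) = replicate n (0 :: nat)"
    by (induction n) simp_all
  ultimately show ?thesis by simp
qed

lemma runs_emit_OAPT_regex:
  fixes pre us k defines "ms \<equiv> pre @ level_words k us"
  assumes s: "tape work_regs r (length pre) ms s" and "us \<noteq> []"
    and r: "r one_reg = 1" "r width_reg = node_length k" "r padding_reg = 5 * 4 ^ k"
      "r count_reg = length us" "r stop_reg = length ms"
    and w: "length (ms @ tokens (OAPT_regex k us)) < 2 ^ w" "7 < (2::nat) ^ w"
  shows "runs w emit_OAPT_regex s (8 * length (tokens (OAPT_regex k us)) + 1)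
    (tape work_regs r (length ms) (ms @ tokens (OAPT_regex k us)))"
proof -
  let ?star = "tokens (RStar (pad (4 ^ k)))"
  let ?X = "?star @ replicate (length us) 0 @ [7]" and ?f = "\<lambda>u. tokens (tensor_regex k u)"
    and ?g = "\<lambda>u. 1 # tokens (tensor_regex k u) @ [2]"
  let ?Y = "concat (map ?g us)"
  have R: "tokens (OAPT_regex k us) = ?X @ ?Y @ ?star" by (rule tokens_OAPT_regex)
  have ms: "ms = pre @ concat (map ?f us)" by (simp add: ms_def level_words_def)
  have "transduces w work_regs 7 r emit_prefix [] ?X"
    using r w \<open>us \<noteq> []\<close> by (intro transduces_emit_prefix) simp_all
  from transducesD[OF this, of pre "level_words k us"]
  have prefix: "runs w emit_prefix s (7 * length ?X) (tape work_regs r (length pre) (ms @ ?X))"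
    using s w(1) unfolding ms_def R by simp
  have choices: "runs w (WhileLess head_reg stop_reg emit_choice) s' (Suc 7 * length ?Y + 1)
      (tape work_regs r (length (pre @ concat (map ?f us))) (pre @ concat (map ?f us) @ ?X @ ?Y))"
    if "tape work_regs r (length pre) (ms @ ?X) s'" for s'
  proof (rule runs_While_head_transduces)
    show "transduces w work_regs 7 r emit_choice (?f u) (?g u)" for u
      using r w by (intro transduces_emit_choice) simp_all
  qed (use that r w(1) in \<open>simp_all add: ms R\<close>)
  have suffix: "runs w emit_star s' (7 * length ?star)
      (tape work_regs r (length ms) (ms @ ?X @ ?Y @ ?star))"
    if "tape work_regs r (length (pre @ concat (map ?f us)))
      (pre @ concat (map ?f us) @ ?X @ ?Y) s'" for s'
  proof -
    have "transduces w work_regs 7 r emit_star [] ?star"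
      using r w by (intro transduces_emit_star) simp_all
    from transducesD[OF this, of ms "?X @ ?Y"] show ?thesis
      using that w(1) unfolding ms R by simp
  qed
  have "runs w emit_OAPT_regex s (7 * length ?X + ((Suc 7 * length ?Y + 1) + 7 * length ?star))
      (tape work_regs r (length ms) (ms @ ?X @ ?Y @ ?star))"
    unfolding emit_OAPT_regex_def block.simps
    by (rule runs_Seq_intermediate[OF prefix runs_Seq_intermediate[OF choices suffix]])
  then show ?thesis by (rule runs_mono) (simp_all add: R)
qed

lemma runs_emit_output:
  assumes ms: "ms = pre @ level_words k us" and "us \<noteq> []"
    and s: "tape level_regs (parameters (length us) k k) (length pre) ms s"
    and w: "length (ms @ tokens (OAPT_regex k us)) < 2 ^ w" "7 < (2::nat) ^ w"
  shows "runs w emit_output s (8 * length (tokens (OAPT_regex k us)) + 3)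
    (tape work_regs
      ((parameters (length us) k k)(stop_reg := length ms, padding_reg := 5 * 4 ^ k))
      (length ms) (ms @ tokens (OAPT_regex k us)))"
    (is "runs w _ _ _ (tape _ ?r _ _)")
proof -
  obtain q where sq: "s = (q, memory ms)" and q: "q free_reg = length ms" "q head_reg = length pre"
      "\<forall>y. y \<notin> level_regs \<union> {free_reg, head_reg} \<longrightarrow> q y = parameters (length us) k k y"
    using s unfolding tape_def by blast
  let ?q = "q(stop_reg := length ms, padding_reg := 5 * 4 ^ k)"
  have "tape work_regs ?r (length pre) ms (?q, memory ms)"
    using q by (auto simp: tape_def)
  then have "runs w emit_OAPT_regex (?q, memory ms) (8 * length (tokens (OAPT_regex k us)) + 1)
      (tape work_regs ?r (length ms) (ms @ tokens (OAPT_regex k us)))"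
    unfolding ms using \<open>us \<noteq> []\<close> w
    by (intro runs_emit_OAPT_regex) (simp_all add: parameters_def ms)
  moreover have "5 * 4 ^ k < (2::nat) ^ w"
    using w(1) by (simp add: tokens_OAPT_regex length_tokens_pad)
  ultimately have "runs w emit_output s (1 + (1 + (8 * length (tokens (OAPT_regex k us)) + 1)))
      (tape work_regs ?r (length ms) (ms @ tokens (OAPT_regex k us)))"
    unfolding emit_output_def block.simps sq
    by (intro runs_Seq runs_Add) (use q w in \<open>simp_all add: parameters_def\<close>)
  then show ?thesis by (rule runs_time) simp
qed

lemma runs_return_registers:
  assumes "tape work_regs r p (ms @ tokens R) s" "r stop_reg = length ms" "r zero_reg = 0"
    and "r size_reg = length S" "ms = pre @ S @ post" "length pre = length S"
    and "length (ms @ tokens R) < 2 ^ w"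
  shows "runs w return_registers s 3 (\<lambda>s. membership_output w s R S)"
proof -
  obtain q where s: "s = (q, memory (ms @ tokens R))" and q: "q free_reg = length (ms @ tokens R)"
      "\<forall>y. y \<notin> work_regs \<union> {free_reg, head_reg} \<longrightarrow> q y = r y"
    using assms(1) unfolding tape_def by blast
  have "stored_at w (memory (ms @ tokens R @ [])) (length ms) (tokens R)"
    using assms by (intro stored_at_memory) simp
  moreover have "stored_at w (memory (pre @ S @ post @ tokens R)) (length pre) S"
    using assms by (intro stored_at_memory) simp
  ultimately have "runs w return_registers s (1 + (1 + 1)) (\<lambda>s. membership_output w s R S)"
    unfolding return_registers_def block.simps s
    by (intro runs_Seq runs_Sub runs_Add)
      (use q assms(2-) in \<open>auto simp: membership_output_def tokens_def regex_length_def\<close>)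
  then show ?thesis by (rule runs_time) simp
qed

lemma OAPT_input_memory:
  "OAPT_input (2 * k) N as bs = ((\<lambda>_. 0)(0 := N, 1 := 2 * k),
     memory (map (\<lambda>u. of_bool (u [])) ((quarters ^^ k) as) @
       concat (map (tensor_words (2 * k)) bs)))"
  by (simp add: OAPT_input_def memory_def flip: tensor_words_quarters)

definition subexpressions :: "nat \<Rightarrow> (bool list \<Rightarrow> bool) list \<Rightarrow> nat list" where
  "subexpressions k us = level_words 0 ((quarters ^^ k) us) @ levels 0 k us"

lemma runs_emit_subexpressions:
  assumes input: "length input = 2 * (N * 4 ^ k)"
      "input = map (\<lambda>u. of_bool (u [])) ((quarters ^^ k) us) @ post"
    and us: "length us = N" "us \<noteq> []"
    and w: "length (input @ subexpressions k us) < 2 ^ w"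
      "10 < (2::nat) ^ w" "5 * 4 ^ k < (2::nat) ^ w" "2 * k < 2 ^ w"
  shows "runs w emit_subexpressions ((\<lambda>_. 0)(0 := N, 1 := 2 * k), memory input)
    (8 * length (subexpressions k us) + 19 * k + 10)
    (\<lambda>s. \<exists>pre. input @ subexpressions k us = pre @ level_words k us \<and>
       tape level_regs (parameters N k k) (length pre) (input @ subexpressions k us) s)"
proof -
  let ?P = "parameters N k" and ?leaves = "level_words 0 ((quarters ^^ k) us)"
  have after_setup: "runs w setup_registers ((\<lambda>_. 0)(0 := N, 1 := 2 * k), memory input) (8 * k + 7)
      (tape work_regs (?P 0) 0 input)"
    using input(1) w by (intro runs_setup_registers) simp_all
  have after_leaves: "runs w emit_leaves s (8 * length ?leaves + 2)
      (tape level_regs (?P 0) (length input) (input @ ?leaves))"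
    if "tape work_regs (?P 0) 0 input s" for s
    using that assms unfolding input(2)
    by (intro runs_emit_leaves) (simp_all add: subexpressions_def)
  have after_levels: "runs w emit_levels s (8 * length (levels 0 k us) + 11 * k + 1)
      (\<lambda>s. \<exists>pre. input @ subexpressions k us = pre @ level_words k us \<and>
         tape level_regs (?P k) (length pre) (input @ subexpressions k us) s)"
    if "tape level_regs (?P 0) (length input) (input @ ?leaves) s" for s
    by (rule runs_mono[OF runs_emit_levels[where k = 0 and d = k and us = us and pre = input]])
      (use that us w in \<open>auto simp: subexpressions_def\<close>)
  have "runs w emit_subexpressions ((\<lambda>_. 0)(0 := N, 1 := 2 * k), memory input)
      ((8 * k + 7) + ((8 * length ?leaves + 2) + (8 * length (levels 0 k us) + 11 * k + 1)))
      (\<lambda>s. \<exists>pre. input @ subexpressions k us = pre @ level_words k us \<and>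
         tape level_regs (?P k) (length pre) (input @ subexpressions k us) s)"
    unfolding emit_subexpressions_def block.simps
    by (rule runs_Seq_intermediate[OF after_setup runs_Seq_intermediate[OF after_leaves after_levels]])
  then show ?thesis by (rule runs_time) (simp add: subexpressions_def)
qed

lemma length_tokens_OAPT_regex:
  "length (tokens (OAPT_regex k us)) =
     10 * 4 ^ k + 7 + length us + length us * (node_length k + 2)"
proof -
  have "length (concat (map (\<lambda>u. 1 # tokens (tensor_regex k u) @ [2]) us)) =
      length us * (node_length k + 2)"
    by (induction us) simp_all
  then show ?thesis by (simp add: tokens_OAPT_regex length_tokens_pad)
qed

lemma constants_less_word_size:
  assumes "length (tokens (OAPT_regex k us)) < 2 ^ w"
  shows "10 < (2::nat) ^ w" "5 * 4 ^ k < (2::nat) ^ w" "2 * k < 2 ^ w"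
proof -
  have "10 * 4 ^ k + 7 < (2::nat) ^ w"
    using assms by (simp add: length_tokens_OAPT_regex)
  moreover have "k < 4 ^ k" by (induction k) auto
  ultimately show "10 < (2::nat) ^ w" "5 * 4 ^ k < (2::nat) ^ w" "2 * k < 2 ^ w" by linarith+
qed

lemma runs_reduction:
  fixes k as bs
  defines "S \<equiv> concat (map (tensor_words (2 * k)) bs)" and "R \<equiv> OAPT_regex k as"
  assumes len: "length as = N" "length bs = N" and "as \<noteq> []"
    and w: "2 * (N * 4 ^ k) + length (subexpressions k as) + length (tokens R) < 2 ^ w"
  shows "runs w reduction (OAPT_input (2 * k) N as bs)
    (8 * length (subexpressions k as) + 8 * length (tokens R) + 19 * k + 16)
    (\<lambda>s. membership_output w s R S)"
proof -
  let ?bits = "map (\<lambda>u. of_bool (u [])) ((quarters ^^ k) as)"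
  let ?ms = "(?bits @ S) @ subexpressions k as" and ?P = "parameters N k k"
  let ?r = "?P(stop_reg := length ?ms, padding_reg := 5 * 4 ^ k)"
  have S: "length S = N * 4 ^ k" and bits: "length ?bits = N * 4 ^ k"
    using len by (simp_all add: S_def power_mult)
  have fits: "length (?ms @ tokens R) < 2 ^ w"
    using w S len by (simp add: ac_simps)
  have bounds: "10 < (2::nat) ^ w" "5 * 4 ^ k < (2::nat) ^ w" "2 * k < 2 ^ w"
    using constants_less_word_size[of k as w] w by (simp_all add: R_def)
  have after_subexpressions: "runs w emit_subexpressions
      ((\<lambda>_. 0)(0 := N, 1 := 2 * k), memory (?bits @ S))
      (8 * length (subexpressions k as) + 19 * k + 10)
      (\<lambda>s. \<exists>pre. ?ms = pre @ level_words k as \<and> tape level_regs ?P (length pre) ?ms s)"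
    by (rule runs_emit_subexpressions) (use S bits len \<open>as \<noteq> []\<close> fits bounds in simp_all)
  have after_output: "runs w emit_output s (8 * length (tokens R) + 3)
      (tape work_regs ?r (length ?ms) (?ms @ tokens R))"
    if "\<exists>pre. ?ms = pre @ level_words k as \<and> tape level_regs ?P (length pre) ?ms s" for s
  proof -
    from that obtain pre where split: "?ms = pre @ level_words k as"
      and tape: "tape level_regs ?P (length pre) ?ms s" by blast
    have "7 < (2::nat) ^ w" using bounds by simp
    from runs_emit_output[OF split \<open>as \<noteq> []\<close>, folded R_def, unfolded len(1), OF tape fits this]
    show ?thesis .
  qed
  have after_return: "runs w return_registers s 3 (\<lambda>s. membership_output w s R S)"
    if "tape work_regs ?r (length ?ms) (?ms @ tokens R) s" for s
    by (rule runs_return_registers[OF that, where pre = ?bits and post = "subexpressions k as"])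
      (use S bits fits in \<open>simp_all add: parameters_def\<close>)
  have "runs w reduction (OAPT_input (2 * k) N as bs)
      ((8 * length (subexpressions k as) + 19 * k + 10) + ((8 * length (tokens R) + 3) + 3))
      (\<lambda>s. membership_output w s R S)"
    unfolding reduction_def block.simps OAPT_input_memory S_def[symmetric]
    by (rule runs_Seq_intermediate[OF after_subexpressions
        runs_Seq_intermediate[OF after_output after_return]])
  then show ?thesis by (rule runs_time) simp
qed

section \<open>Resource bounds\<close>

lemma length_levels_le:
  "length (level_words k ((quarters ^^ d) us) @ levels k d us) \<le>
     Suc d * ((5 * (k + d) + 6) * 4 ^ (k + d) * length us)"
proof (induction d arbitrary: k)
  case 0
  then show ?case by (simp flip: Suc_node_length)
next
  case (Suc d)
  let ?B = "(5 * (k + Suc d) + 6) * 4 ^ (k + Suc d) * length us"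
  have "4 ^ Suc d * length us * node_length k \<le> 4 ^ Suc d * length us * ((5 * k + 6) * 4 ^ k)"
    by (intro mult_le_mono2) (simp flip: Suc_node_length)
  also have "\<dots> = (5 * k + 6) * 4 ^ (k + Suc d) * length us"
    by (simp add: power_add)
  also have "\<dots> \<le> ?B"
    by (intro mult_le_mono1) simp
  finally have "length (level_words k ((quarters ^^ Suc d) us)) \<le> ?B"
    by (simp only: length_level_words length_funpow_quarters)
  moreover have "length (levels k (Suc d) us) \<le> Suc d * ?B"
    using Suc.IH[of "Suc k"] by (simp only: add_Suc_shift levels.simps)
  ultimately show ?case
    by (simp only: length_append mult_Suc)
qed

lemma length_subexpressions_le:
  "length (subexpressions k us) \<le> 6 * (length us * (4 ^ k)\<^sup>2)"
proof -
  have "Suc k * (5 * k + 6) \<le> 6 * 4 ^ k"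
    by (induction k) (simp_all add: algebra_simps)
  then have "Suc k * (5 * k + 6) * (4 ^ k * length us) \<le> 6 * 4 ^ k * (4 ^ k * length us)"
    by (rule mult_le_mono1)
  then show ?thesis
    using length_levels_le[of 0 k us]
    by (simp add: subexpressions_def power2_eq_square algebra_simps)
qed

lemma length_tokens_OAPT_regex_le:
  assumes "us \<noteq> []"
  shows "length (tokens (OAPT_regex k us)) \<le> 26 * (length us * (4 ^ k)\<^sup>2)"
proof -
  have "5 * k + 6 \<le> 6 * 4 ^ k" by (induction k) simp_all
  then have "(5 * k + 6) * 4 ^ k \<le> 6 * 4 ^ k * 4 ^ k" by (rule mult_le_mono1)
  then have "node_length k \<le> 6 * (4 ^ k)\<^sup>2"
    by (simp add: power2_eq_square flip: Suc_node_length)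
  then have "length us * node_length k \<le> length us * (6 * (4 ^ k)\<^sup>2)"
    by (rule mult_le_mono2)
  moreover have "1 * 4 ^ k \<le> length us * (4 ^ k)\<^sup>2" "length us * 1 \<le> length us * (4 ^ k)\<^sup>2"
    using assms by (intro mult_le_mono; simp add: Suc_le_eq power2_eq_square)+
  moreover have "1 \<le> length us"
    using assms by (simp add: Suc_le_eq)
  ultimately show ?thesis
    unfolding length_tokens_OAPT_regex distrib_left by linarith
qed

lemma runs_reduction_bound:
  fixes k N as bs defines "bound \<equiv> 300 * N * (2 ^ (2 * k))\<^sup>2"
  assumes len: "length as = N" "length bs = N" and "0 < N" and w: "bound \<le> 2 ^ w"
  shows "runs w reduction (OAPT_input (2 * k) N as bs) bound
    (\<lambda>s. membership_output w s (OAPT_regex k as) (concat (map (tensor_words (2 * k)) bs)))"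
proof -
  define X where "X = N * (4 ^ k)\<^sup>2"
  have bound: "bound = 300 * X" by (simp add: bound_def X_def power_mult)
  have "as \<noteq> []" using len \<open>0 < N\<close> by auto
  have words: "length (subexpressions k as) \<le> 6 * X" "length (tokens (OAPT_regex k as)) \<le> 26 * X"
    using length_subexpressions_le[of k as] length_tokens_OAPT_regex_le[OF \<open>as \<noteq> []\<close>, of k] len
    by (simp_all add: X_def)
  have "k < 4 ^ k" by (induction k) auto
  have "N * 4 ^ k \<le> X" "4 ^ k \<le> X" "1 \<le> X"
    using \<open>0 < N\<close> by (simp_all add: X_def power2_eq_square Suc_le_eq)
  with words \<open>k < 4 ^ k\<close> w show ?thesis
    unfolding bound using len \<open>as \<noteq> []\<close> by (intro runs_time[OF runs_reduction]) linarith+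
qed

theorem theorem7p6:
  shows "\<exists>(P :: prog) (C :: nat) (c :: nat).
    \<forall>(t :: nat) (N :: nat) (A :: (bool list \<Rightarrow> bool) set) (B :: (bool list \<Rightarrow> bool) set) as bs.
      restricted_OAPT_instance t N A B \<and> enumerates as A \<and> enumerates bs B \<longrightarrow>
      (let D = 2 ^ t; bound = C * N * D ^ c in
        \<exists>(R :: nat regex) (S :: nat list).
          regex_length R \<le> bound \<and> length S \<le> bound \<and>
          (S \<in> lang R \<longleftrightarrow> OAPT t A B) \<and>
          (\<forall>w. bound \<le> 2 ^ w \<longrightarrow>
            (\<exists>T s. exec w P (OAPT_input t N as bs) T s \<and> T \<le> bound \<and>
              membership_output w s R S)))"
proof (rule exI[of _ reduction], rule exI[of _ 300], rule exI[of _ 2], intro allI impI, elim conjE)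
  fix t N A B as bs
  assume inst: "restricted_OAPT_instance t N A B" and enum: "enumerates as A" "enumerates bs B"
  from inst obtain k where t: "t = 2 * k" and "0 < N" and len: "length as = N" "length bs = N"
    using enum by (auto simp: restricted_OAPT_instance_def enumerates_def distinct_card elim: evenE)
  let ?R = "OAPT_regex k as" and ?S = "concat (map (tensor_words t) bs)"
  let ?bound = "300 * N * (2 ^ t)\<^sup>2"
  have "regex_length ?R \<le> ?bound"
    using length_tokens_OAPT_regex_le[of as k] len \<open>0 < N\<close>
    by (auto simp: regex_length_def tokens_def t power_mult)
  moreover have "length ?S \<le> ?bound"
    using len by (simp add: power2_eq_square)
  moreover have "?S \<in> lang ?R \<longleftrightarrow> OAPT t A B"
    using in_lang_OAPT_regex_iff[of k bs as] enum by (simp add: t enumerates_def)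
  moreover have "\<exists>T s. exec w reduction (OAPT_input t N as bs) T s \<and> T \<le> ?bound \<and>
      membership_output w s ?R ?S" if "?bound \<le> 2 ^ w" for w
    using runs_reduction_bound[OF len \<open>0 < N\<close>] that unfolding t runs_def by blast
  ultimately show "let D = 2 ^ t; bound = 300 * N * D\<^sup>2 in
      \<exists>R S. regex_length R \<le> bound \<and> length S \<le> bound \<and> (S \<in> lang R \<longleftrightarrow> OAPT t A B) \<and>
        (\<forall>w. bound \<le> 2 ^ w \<longrightarrow> (\<exists>T s. exec w reduction (OAPT_input t N as bs) T s \<and> T \<le> bound \<and>
          membership_output w s R S))"
    unfolding Let_def by blast
qed

end
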